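(* Let $((X^n(t))_{t\in[0,T]})_{n\in\mathbb{N}}$ be a family of $p$-dimensional, continuous, centered Gaussian processes, starting from zero, with independent components, which satisfies an LDP on $C([0,T],\mathbb{R}^p)$ with speed $\gamma_n$ and good rate function $$I(h)=\sum_{i=1}^p I_i(h_i),\qquad I_i(h_i)=\begin{cases}\frac12\|h_i\|^2_{\mathscr{H}_i} & h_i\in\mathscr{H}_i\\ +\infty & h_i\notin\mathscr{H}_i,\end{cases}$$ where $\mathscr{H}_i\subset C([0,T],\mathbb{R})$ is the reproducing kernel Hilbert space associated to some covariance function $k_{ii}$. Let $(\widetilde A^n)_{n\in\mathbb{N}}$ be a family of positive random variables, independent of $(X^n)_{n\in\mathbb{N}}$, satisfying the LDP on $[0,+\infty)$ with speed $\gamma_n$ and good rate function $x\mapsto dx^\theta$ ($x\ge0$) for some $d,\theta>0$. Let $\hat b=(\hat b_1,\ldots,\hat b_p)\in C([0,T],\mathbb{R}^p)$ and $$Z^n(t)=\widetilde A^nX^n(t)+\hat b(t)\quad(t\in[0,T]).$$ Let $0\ne\xi\in\mathbb{R}^p$ with $\xi_i\ge0$ for $i=1,\ldots,p$, and let $x>0$ be such that $x-\langle\hat b(t),\xi\rangle>0$ for every $t\in[0,T]$. Set $$p_n:=\mathbb{P}\Big(\sup_{t\in[0,T]}\langle Z^n(t),\xi\rangle\ge x\Big).$$ Then $$\lim_{n\to+\infty}\frac1{\gamma_n}\log(p_n)=-w_H^{(=)},\qquad w_H^{(=)}:=\psi(d,\theta)\inf_{t\in[0,T]}\left[\frac12\,\frac{(-\langle\hat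 b(t),\xi\rangle+x)^2}{\sum_{j=1}^p\xi_j^2k_{jj}(t,t)}\right]^{\theta/(\theta+2)}.$$
   Context: $T>0$ and $p\ge1$ are fixed; $\langle\cdot,\cdot\rangle$ is the Euclidean inner product on $\mathbb{R}^p$; $C([0,T],\mathbb{R}^p)$ carries the sup-norm. For $d,\theta>0$, $$\psi(d,\theta):=2^{\theta/(\theta+2)}\Big(d(d\theta)^{-\theta/(\theta+2)}+\frac12(d\theta)^{2/(\theta+2)}\Big).$$ Quotients with positive numerator and zero denominator (e.g. at $t=0$, where $k_{ii}(0,0)=0$) are read as $+\infty$; a positive power of $+\infty$ is $+\infty$; $\log 0=-\infty$. Large deviation principle (LDP): let $E$ be a topological space with Borel $\sigma$-algebra and $\gamma_n>0$ with $\gamma_n\to+\infty$ (the speed). A rate function is a lower semicontinuous $I:E\to[0,+\infty]$; it is good if $\{I\le a\}$ is compact for all $a\ge0$. Probability measures $(\mu_n)$ satisfy the LDP on $E$ with rate function $I$ and speed $\gamma_n$ if $\liminf_n\frac1{\gamma_n}\log\mu_n(\Theta)\ge-\inf_{x\in\Theta}I(x)$ for every open $\Theta$ and $\limsup_n\frac1{\gamma_n}\log\mu_n(\Gamma)\le-\inf_{x\in\Gamma}I(x)$ for every closed $\Gamma$. Random elements satisfy an LDP if their laws do. Reproducing kernel Hilbert space (RKHS): let $U=(U(t))_{t\in[0,T]}$ be a real continuous centered Gaussian process with covariance function $k$. Let $H$ be the $L^2$-closure of $\{\int_0^TU(t)\,d\lambda(t):\lambda\text{ a signed measure on }[0,T]\}$.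 The RKHS of $k$ is $\mathscr{H}=\{h: h(t)=\mathbb{E}[U(t)Y],\ Y\in H\}\subset C([0,T],\mathbb{R})$, with inner product transported from $L^2$ by the bijection $Y\mapsto\mathbb{E}[U(\cdot)Y]$. Equivalently it is the completion of the functions $x(t)=\int_0^Tk(t,s)\,d\lambda(s)$ under $\|x\|^2=\int_0^T\int_0^Tk(t,s)\,d\lambda(t)\,d\lambda(s)$. *)

theory Defs
  imports "HOL-Probability.Probability"
begin

section \<open>Extended-real conventions\<close>

definition log_ereal :: "real \<Rightarrow> ereal" where
  "log_ereal r = (if r \<le> 0 then - \<infinity> else ereal (ln r))"

text \<open>Only used for nonnegative base and positive exponent.\<close>

definition ereal_powr :: "ereal \<Rightarrow> real \<Rightarrow> ereal" where
  "ereal_powr x a = (if x = \<infinity> then \<infinity> else ereal (real_of_ereal x powr a))"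

definition psi :: "real \<Rightarrow> real \<Rightarrow> real" where
  "psi d \<theta> = 2 powr (\<theta> / (\<theta> + 2)) *
     (d * (d * \<theta>) powr (- \<theta> / (\<theta> + 2)) + 1 / 2 * (d * \<theta>) powr (2 / (\<theta> + 2)))"


section \<open>Large deviation principles\<close>

definition borel_sigma :: "'a topology \<Rightarrow> 'a measure" where
  "borel_sigma E = sigma (topspace E) {S. openin E S}"

definition speed :: "(nat \<Rightarrow> real) \<Rightarrow> bool" where
  "speed \<gamma> \<longleftrightarrow> (\<forall>n. 0 < \<gamma> n) \<and> filterlim \<gamma> at_top sequentially"

text \<open>Values of a rate function outside \<open>topspace E\<close> are irrelevant.\<close>

definition rate_function :: "'a topology \<Rightarrow> ('a \<Rightarrow> ereal) \<Rightarrow> bool" where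
  "rate_function E I \<longleftrightarrow>
     (\<forall>x\<in>topspace E. 0 \<le> I x) \<and>
     (\<forall>a::real. closedin E {x \<in> topspace E. I x \<le> ereal a})"

definition good_rate_function :: "'a topology \<Rightarrow> ('a \<Rightarrow> ereal) \<Rightarrow> bool" where
  "good_rate_function E I \<longleftrightarrow>
     rate_function E I \<and>
     (\<forall>a\<ge>0. compactin E {x \<in> topspace E. I x \<le> ereal a})"

definition LDP ::
  "'a topology \<Rightarrow> (nat \<Rightarrow> 'a measure) \<Rightarrow> (nat \<Rightarrow> real) \<Rightarrow> ('a \<Rightarrow> ereal) \<Rightarrow> bool" where
  "LDP E \<mu> \<gamma> I \<longleftrightarrow>
     (\<forall>n. prob_space (\<mu> n) \<and> sets (\<mu> n) = sets (borel_sigma E)) \<and>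
     speed \<gamma> \<and> rate_function E I \<and>
     (\<forall>S. openin E S \<longrightarrow>
        - (INF x\<in>S. I x) \<le> liminf (\<lambda>n. log_ereal (measure (\<mu> n) S) / ereal (\<gamma> n))) \<and>
     (\<forall>C. closedin E C \<longrightarrow>
        limsup (\<lambda>n. log_ereal (measure (\<mu> n) C) / ereal (\<gamma> n)) \<le> - (INF x\<in>C. I x))"

definition random_LDP ::
  "'w measure \<Rightarrow> 'a topology \<Rightarrow> (nat \<Rightarrow> 'w \<Rightarrow> 'a) \<Rightarrow> (nat \<Rightarrow> real) \<Rightarrow> ('a \<Rightarrow> ereal) \<Rightarrow> bool" where
  "random_LDP M E Y \<gamma> I \<longleftrightarrow>
     (\<forall>n. Y n \<in> measurable M (borel_sigma E)) \<and>
     LDP E (\<lambda>n. distr M (borel_sigma E) (Y n)) \<gamma> I"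


section \<open>Continuous paths and Gaussian processes\<close>

text \<open>\<open>C([0,T], 'b)\<close> with the sup-metric. Its points are functions on the reals that are
  \<open>undefined\<close> off \<open>[0,T]\<close>, so a path has to be restricted to become a point.\<close>

definition path_topology :: "real \<Rightarrow> (real \<Rightarrow> 'b::metric_space) topology" where
  "path_topology T = mtopology_of (cfunspace (top_of_set {0..T}) euclidean_metric)"

definition sample_path :: "real \<Rightarrow> (real \<Rightarrow> 'w \<Rightarrow> 'b) \<Rightarrow> 'w \<Rightarrow> (real \<Rightarrow> 'b)" where
  "sample_path T Y \<omega> = (\<lambda>t\<in>{0..T}. Y t \<omega>)"

definition component :: "real \<Rightarrow> 'p \<Rightarrow> (real \<Rightarrow> real ^ 'p) \<Rightarrow> (real \<Rightarrow> real)" where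
  "component T i h = (\<lambda>t\<in>{0..T}. h t $ i)"

text \<open>The point mass at zero is a (degenerate) centered normal distribution.\<close>

definition centered_normal :: "'w measure \<Rightarrow> ('w \<Rightarrow> real) \<Rightarrow> bool" where
  "centered_normal M Y \<longleftrightarrow>
     Y \<in> borel_measurable M \<and>
     ((AE \<omega> in M. Y \<omega> = 0) \<or> (\<exists>\<sigma>>0. distributed M lborel Y (normal_density 0 \<sigma>)))"

definition centered_gaussian_process ::
  "'w measure \<Rightarrow> real \<Rightarrow> (real \<Rightarrow> 'w \<Rightarrow> 'b::euclidean_space) \<Rightarrow> bool" where
  "centered_gaussian_process M T Y \<longleftrightarrow>
     (\<forall>J c. finite J \<and> J \<subseteq> {0..T} \<longrightarrow> centered_normal M (\<lambda>\<omega>. \<Sum>t\<in>J. c t \<bullet> Y t \<omega>))"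

definition continuous_process ::
  "'w measure \<Rightarrow> real \<Rightarrow> (real \<Rightarrow> 'w \<Rightarrow> 'b::topological_space) \<Rightarrow> bool" where
  "continuous_process M T Y \<longleftrightarrow> (\<forall>\<omega>\<in>space M. continuous_on {0..T} (\<lambda>t. Y t \<omega>))"

definition covariance_function ::
  "'w measure \<Rightarrow> real \<Rightarrow> (real \<Rightarrow> 'w \<Rightarrow> real) \<Rightarrow> (real \<Rightarrow> real \<Rightarrow> real) \<Rightarrow> bool" where
  "covariance_function M T U k \<longleftrightarrow>
     (\<forall>s\<in>{0..T}. \<forall>t\<in>{0..T}. k s t =
        (\<integral>\<omega>. (U s \<omega> - (\<integral>\<omega>'. U s \<omega>' \<partial>M)) * (U t \<omega> - (\<integral>\<omega>'. U t \<omega>' \<partial>M)) \<partial>M))"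

text \<open>The events of the sigma-algebra generated by a family of random variables; stated this way
  because \<open>indep_var\<close> forces both random elements to have the same codomain type.\<close>

definition generated_events ::
  "'w measure \<Rightarrow> 'j set \<Rightarrow> ('j \<Rightarrow> 'w \<Rightarrow> 'b::topological_space) \<Rightarrow> 'w set set" where
  "generated_events M J Y =
     sets (vimage_algebra (space M) (\<lambda>\<omega>. \<lambda>j\<in>J. Y j \<omega>) (Pi\<^sub>M J (\<lambda>_. borel)))"


section \<open>The reproducing kernel Hilbert space of a Gaussian process\<close>

text \<open>Integrals against (finite) signed measures on \<open>[0,T]\<close>; a signed measure is written as a
  difference of two finite Borel measures.\<close>

definition finite_borel_measures :: "real \<Rightarrow> real measure set" where
  "finite_borel_measures T =
     {\<nu>. finite_measure \<nu> \<and> sets \<nu> = sets (restrict_space borel {0..T})}"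

definition signed_integrals :: "real \<Rightarrow> (real \<Rightarrow> 'w \<Rightarrow> real) \<Rightarrow> ('w \<Rightarrow> real) set" where
  "signed_integrals T U =
     {(\<lambda>\<omega>. (\<integral>t. U t \<omega> \<partial>\<nu>1) - (\<integral>t. U t \<omega> \<partial>\<nu>2)) | \<nu>1 \<nu>2.
        \<nu>1 \<in> finite_borel_measures T \<and> \<nu>2 \<in> finite_borel_measures T}"

definition L2_closure :: "'w measure \<Rightarrow> ('w \<Rightarrow> real) set \<Rightarrow> ('w \<Rightarrow> real) set" where
  "L2_closure M S =
     {Y \<in> borel_measurable M. integrable M (\<lambda>\<omega>. (Y \<omega>)\<^sup>2) \<and>
        (\<forall>\<epsilon>>0. \<exists>V\<in>S. integrable M (\<lambda>\<omega>. (Y \<omega> - V \<omega>)\<^sup>2) \<and> (\<integral>\<omega>. (Y \<omega> - V \<omega>)\<^sup>2 \<partial>M) < \<epsilon>)}"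

definition gaussian_space ::
  "'w measure \<Rightarrow> real \<Rightarrow> (real \<Rightarrow> 'w \<Rightarrow> real) \<Rightarrow> ('w \<Rightarrow> real) set" where
  "gaussian_space M T U = L2_closure M (signed_integrals T U)"

definition rkhs_map ::
  "'w measure \<Rightarrow> real \<Rightarrow> (real \<Rightarrow> 'w \<Rightarrow> real) \<Rightarrow> ('w \<Rightarrow> real) \<Rightarrow> (real \<Rightarrow> real)" where
  "rkhs_map M T U Y = (\<lambda>t\<in>{0..T}. \<integral>\<omega>. U t \<omega> * Y \<omega> \<partial>M)"

definition rkhs :: "'w measure \<Rightarrow> real \<Rightarrow> (real \<Rightarrow> 'w \<Rightarrow> real) \<Rightarrow> (real \<Rightarrow> real) set" where
  "rkhs M T U = rkhs_map M T U ` gaussian_space M T U"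

text \<open>\<open>gaussian_space\<close> consists of functions rather than almost-everywhere classes, so the preimage
  chosen by \<open>inv_into\<close> is unique only up to null sets, which the integral ignores.\<close>

definition rkhs_inner ::
  "'w measure \<Rightarrow> real \<Rightarrow> (real \<Rightarrow> 'w \<Rightarrow> real) \<Rightarrow> (real \<Rightarrow> real) \<Rightarrow> (real \<Rightarrow> real) \<Rightarrow> real" where
  "rkhs_inner M T U g h =
     (\<integral>\<omega>. inv_into (gaussian_space M T U) (rkhs_map M T U) g \<omega> *
          inv_into (gaussian_space M T U) (rkhs_map M T U) h \<omega> \<partial>M)"

definition rkhs_norm ::
  "'w measure \<Rightarrow> real \<Rightarrow> (real \<Rightarrow> 'w \<Rightarrow> real) \<Rightarrow> (real \<Rightarrow> real) \<Rightarrow> real" where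
  "rkhs_norm M T U h = sqrt (rkhs_inner M T U h h)"

definition rkhs_rate ::
  "'w measure \<Rightarrow> real \<Rightarrow> (real \<Rightarrow> 'w \<Rightarrow> real) \<Rightarrow> (real \<Rightarrow> real) \<Rightarrow> ereal" where
  "rkhs_rate M T U h =
     (if h \<in> rkhs M T U then ereal (1 / 2 * (rkhs_norm M T U h)\<^sup>2) else \<infinity>)"


section \<open>The decay rate\<close>

text \<open>In \<open>ereal\<close>, a positive number divided by \<open>0\<close> is \<open>\<infinity>\<close>.\<close>

definition w_H_eq ::
  "real \<Rightarrow> real \<Rightarrow> real \<Rightarrow> ('p::finite \<Rightarrow> real \<Rightarrow> real \<Rightarrow> real) \<Rightarrow>
   (real \<Rightarrow> real ^ 'p) \<Rightarrow> real ^ 'p \<Rightarrow> real \<Rightarrow> ereal" where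
  "w_H_eq T d \<theta> k b \<xi> x =
     ereal (psi d \<theta>) *
     (INF t\<in>{0..T}. ereal_powr
        (ereal (1 / 2) * (ereal ((- (b t \<bullet> \<xi>) + x)\<^sup>2) / ereal (\<Sum>j\<in>UNIV. (\<xi> $ j)\<^sup>2 * k j t t)))
        (\<theta> / (\<theta> + 2)))"

end

theory Submission
  imports Defs
begin

text \<open>
  Write \<open>f(t) = x - \<langle>b(t),\<xi>\<rangle>\<close>, which is positive, and let \<open>\<Sigma>(t) = \<Sum>\<^sub>j \<xi>\<^sub>j\<^sup>2 k\<^sub>j\<^sub>j(t,t)\<close> be the variance of
  \<open>\<langle>U(t),\<xi>\<rangle>\<close> when the components of \<open>U\<close> are independent.
  The supremum of \<open>\<langle>Z\<^sup>n(t),\<xi>\<rangle>\<close> reaches \<open>x\<close> exactly if \<open>A\<^sup>n V\<^sup>n \<ge> 1\<close>, where \<open>V\<^sup>n\<close> is the supremum of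
  \<open>\<langle>X\<^sup>n(t),\<xi>\<rangle> / f(t)\<close>. As \<open>A\<^sup>n\<close> and \<open>V\<^sup>n\<close> are independent, the problem splits into their two tails.

  The tail \<open>A\<^sup>n \<ge> y\<close> has exponent \<open>d y\<^sup>\<theta>\<close>. The tail \<open>V\<^sup>n \<ge> u\<close> has exponent \<open>m u\<^sup>2\<close> with
  \<open>m\<close> the infimum of \<open>f(t)\<^sup>2 / (2 \<Sigma>(t))\<close> over \<open>t\<close>. The reason is that evaluation at \<open>t\<close> is a bounded
  functional on the reproducing kernel Hilbert space, of squared norm \<open>k(t,t)\<close>, so that a path \<open>h\<close> with \<open>\<langle>h(t),\<xi>\<rangle> \<ge> u f(t)\<close> costs at least
  \<open>u\<^sup>2 f(t)\<^sup>2 / (2 \<Sigma>(t))\<close> (\<open>gaussian_rate_ge\<close>), and multiples of the kernel section \<open>k(\<cdot>,t)\<close> attain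
  this cost (\<open>gaussian_rate_attained\<close>).

  By independence \<open>A\<^sup>n V\<^sup>n \<ge> 1\<close> is as likely as its cheapest realization \<open>A\<^sup>n \<approx> y\<close>, \<open>V\<^sup>n \<approx> 1/y\<close>, of cost
  \<open>d y\<^sup>\<theta> + m / y\<^sup>2\<close>; a finite geometric grid of values of \<open>y\<close> suffices for the upper bound, since very small and
  very large \<open>y\<close> are too expensive (\<open>product_decays_at_least\<close>, \<open>product_decays_at_most\<close>). The minimum of this
  cost over \<open>y\<close> is \<open>\<psi>(d,\<theta>) m\<^bsup>\<theta>/(\<theta>+2)\<^esup>\<close> (\<open>psi_le\<close>, \<open>psi_attained\<close>).

  What remains concerns the Hilbert space itself. Its norm is that of a chosen preimage in the Gaussian space, so
  the norm of a kernel section is known only once preimages are known to be unique almost surely. This is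
  \<open>orthogonal_to_closure\<close>, which rests on Fubini's theorem for path integrals and hence on bounded
  variances. Both boundedness of the variances and continuity of the kernel sections follow from path continuity:
  for centered normal variables, convergence in probability to zero forces convergence in mean square.
\<close>

section \<open>Exponential decay rates\<close>

text \<open>The exponential bounds in a large deviation principle are used in the form that they hold eventually,
  with an arbitrarily small loss in the exponent. In this form they are stable under
  products and finite sums, and zero probabilities need no special treatment.\<close>

definition decays_at_least :: "(nat \<Rightarrow> real) \<Rightarrow> (nat \<Rightarrow> real) \<Rightarrow> real \<Rightarrow> bool" where
  "decays_at_least \<gamma> P c \<longleftrightarrow> (\<forall>c'<c. \<forall>\<^sub>F n in sequentially. P n \<le> exp (- (\<gamma> n * c')))"

definition decays_at_most :: "(nat \<Rightarrow> real) \<Rightarrow> (nat \<Rightarrow> real) \<Rightarrow> real \<Rightarrow> bool" where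
  "decays_at_most \<gamma> P c \<longleftrightarrow> (\<forall>c'>c. \<forall>\<^sub>F n in sequentially. exp (- (\<gamma> n * c')) \<le> P n)"

lemma speed_pos: "speed \<gamma> \<Longrightarrow> 0 < \<gamma> n"
  by (simp add: speed_def)

lemma log_ereal_div_less_iff:
  assumes "0 < g"
  shows "log_ereal r / ereal g < ereal c \<longleftrightarrow> r < exp (g * c)"
proof (cases "r \<le> 0")
  case True
  then have "r < exp (g * c)"
    by (rule le_less_trans) simp
  with True assms show ?thesis
    by (simp add: log_ereal_def)
next
  case False
  then have "r < exp (g * c) \<longleftrightarrow> ln r < g * c"
    by (metis exp_less_cancel_iff exp_ln linorder_not_le)
  with False assms show ?thesis
    by (simp add: log_ereal_def field_simps)
qed

lemma less_log_ereal_div_iff: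
  assumes "0 < g"
  shows "ereal c < log_ereal r / ereal g \<longleftrightarrow> exp (g * c) < r"
proof (cases "r \<le> 0")
  case True
  then have "\<not> exp (g * c) < r"
    by (metis exp_gt_zero order_less_le_trans linorder_not_less order_less_imp_le)
  with True assms show ?thesis
    by (simp add: log_ereal_def)
next
  case False
  then have "exp (g * c) < r \<longleftrightarrow> g * c < ln r"
    by (metis exp_less_cancel_iff exp_ln linorder_not_le)
  with False assms show ?thesis
    by (simp add: log_ereal_def field_simps)
qed

lemma decays_at_least_if_limsup:
  assumes \<gamma>: "speed \<gamma>"
    and lim: "limsup (\<lambda>n. log_ereal (P n) / ereal (\<gamma> n)) \<le> - C" and "ereal c \<le> C"
  shows "decays_at_least \<gamma> P c"
  unfolding decays_at_least_def
proof (intro allI impI)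
  fix c' assume "c' < c"
  then have "ereal c' < C"
    using assms(3) by (metis less_ereal.simps(1) order_less_le_trans)
  then have "- C < ereal (- c')"
    by (metis ereal_minus_less_minus uminus_ereal.simps(1))
  then have "\<forall>\<^sub>F n in sequentially. log_ereal (P n) / ereal (\<gamma> n) < ereal (- c')"
    using lim by (intro Limsup_lessD) (rule le_less_trans)
  then show "\<forall>\<^sub>F n in sequentially. P n \<le> exp (- (\<gamma> n * c'))"
    by eventually_elim (use log_ereal_div_less_iff[OF speed_pos[OF \<gamma>]] in force)
qed

lemma decays_at_most_if_liminf:
  assumes \<gamma>: "speed \<gamma>"
    and lim: "- C \<le> liminf (\<lambda>n. log_ereal (P n) / ereal (\<gamma> n))" and "C \<le> ereal c"
  shows "decays_at_most \<gamma> P c"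
  unfolding decays_at_most_def
proof (intro allI impI)
  fix c' assume "c < c'"
  then have "C < ereal c'"
    using assms(3) by (metis less_ereal.simps(1) order_le_less_trans)
  then have "ereal (- c') < - C"
    by (metis ereal_minus_less_minus uminus_ereal.simps(1))
  then have "\<forall>\<^sub>F n in sequentially. ereal (- c') < log_ereal (P n) / ereal (\<gamma> n)"
    using lim by (intro less_LiminfD) (rule less_le_trans)
  then show "\<forall>\<^sub>F n in sequentially. exp (- (\<gamma> n * c')) \<le> P n"
    by eventually_elim (use less_log_ereal_div_iff[OF speed_pos[OF \<gamma>]] in force)
qed

lemma decays_at_least_mono:
  assumes "decays_at_least \<gamma> Q c" and "\<And>n. P n \<le> Q n" and "c' \<le> c"
  shows "decays_at_least \<gamma> P c'"
  unfolding decays_at_least_def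
proof (intro allI impI)
  fix b assume "b < c'"
  then have "\<forall>\<^sub>F n in sequentially. Q n \<le> exp (- (\<gamma> n * b))"
    using assms(1,3) by (simp add: decays_at_least_def)
  then show "\<forall>\<^sub>F n in sequentially. P n \<le> exp (- (\<gamma> n * b))"
    by eventually_elim (use assms(2) order_trans in blast)
qed

lemma decays_at_most_mono:
  assumes "decays_at_most \<gamma> Q c" and "\<And>n. Q n \<le> P n"
  shows "decays_at_most \<gamma> P c"
  unfolding decays_at_most_def
proof (intro allI impI)
  fix b assume "c < b"
  then have "\<forall>\<^sub>F n in sequentially. exp (- (\<gamma> n * b)) \<le> Q n"
    using assms(1) by (simp add: decays_at_most_def)
  then show "\<forall>\<^sub>F n in sequentially. exp (- (\<gamma> n * b)) \<le> P n"
    by eventually_elim (use assms(2) order_trans in blast)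
qed

lemma decays_at_most_closed:
  assumes "\<And>b. c < b \<Longrightarrow> \<exists>c'<b. decays_at_most \<gamma> P c'"
  shows "decays_at_most \<gamma> P c"
  using assms unfolding decays_at_most_def by blast

lemma decays_at_least_closed:
  assumes "\<And>b. b < c \<Longrightarrow> \<exists>c'>b. decays_at_least \<gamma> P c'"
  shows "decays_at_least \<gamma> P c"
  using assms unfolding decays_at_least_def by blast

lemma decays_at_least_mult:
  assumes P: "decays_at_least \<gamma> P a" and Q: "decays_at_least \<gamma> Q b"
    and nonneg: "\<And>n. 0 \<le> P n" "\<And>n. 0 \<le> Q n"
  shows "decays_at_least \<gamma> (\<lambda>n. P n * Q n) (a + b)"
  unfolding decays_at_least_def
proof (intro allI impI)
  fix c assume "c < a + b"
  define e where "e = (a + b - c) / 2"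
  have e: "0 < e" "c = (a - e) + (b - e)"
    using \<open>c < a + b\<close> by (auto simp: e_def field_simps)
  have "\<forall>\<^sub>F n in sequentially. P n \<le> exp (- (\<gamma> n * (a - e)))"
    and "\<forall>\<^sub>F n in sequentially. Q n \<le> exp (- (\<gamma> n * (b - e)))"
    using P Q e by (auto simp: decays_at_least_def)
  then show "\<forall>\<^sub>F n in sequentially. P n * Q n \<le> exp (- (\<gamma> n * c))"
  proof eventually_elim
    case (elim n)
    then have "P n * Q n \<le> exp (- (\<gamma> n * (a - e))) * exp (- (\<gamma> n * (b - e)))"
      using nonneg by (intro mult_mono) auto
    also have "\<dots> = exp (- (\<gamma> n * c))"
      by (simp add: e(2) exp_add[symmetric] algebra_simps)
    finally show ?case .
  qed
qed

lemma decays_at_most_mult: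
  assumes P: "decays_at_most \<gamma> P a" and Q: "decays_at_most \<gamma> Q b"
    and nonneg: "\<And>n. 0 \<le> P n" "\<And>n. 0 \<le> Q n"
  shows "decays_at_most \<gamma> (\<lambda>n. P n * Q n) (a + b)"
  unfolding decays_at_most_def
proof (intro allI impI)
  fix c assume "a + b < c"
  define e where "e = (c - a - b) / 2"
  have e: "0 < e" "c = (a + e) + (b + e)"
    using \<open>a + b < c\<close> by (auto simp: e_def field_simps)
  have "\<forall>\<^sub>F n in sequentially. exp (- (\<gamma> n * (a + e))) \<le> P n"
    and "\<forall>\<^sub>F n in sequentially. exp (- (\<gamma> n * (b + e))) \<le> Q n"
    using P Q e by (auto simp: decays_at_most_def)
  then show "\<forall>\<^sub>F n in sequentially. exp (- (\<gamma> n * c)) \<le> P n * Q n"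
  proof eventually_elim
    case (elim n)
    have "exp (- (\<gamma> n * c)) = exp (- (\<gamma> n * (a + e))) * exp (- (\<gamma> n * (b + e)))"
      by (simp add: e(2) exp_add[symmetric] algebra_simps)
    also have "\<dots> \<le> P n * Q n"
      using nonneg elim by (intro mult_mono) auto
    finally show ?case .
  qed
qed

text \<open>A finite sum decays as fast as its slowest term, because a constant factor is absorbed by an
  arbitrarily small loss in the exponent.\<close>

lemma decays_at_least_sum:
  fixes J :: "'j set"
  assumes \<gamma>: "speed \<gamma>" and "finite J" and P: "\<And>j. j \<in> J \<Longrightarrow> decays_at_least \<gamma> (P j) c"
  shows "decays_at_least \<gamma> (\<lambda>n. \<Sum>j\<in>J. P j n) c"
  unfolding decays_at_least_def
proof (intro allI impI)
  fix c' assume "c' < c"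
  define e where "e = (c - c') / 2"
  have e: "0 < e" "c' + e < c"
    using \<open>c' < c\<close> by (auto simp: e_def field_simps)
  have "\<forall>\<^sub>F n in sequentially. \<forall>j\<in>J. P j n \<le> exp (- (\<gamma> n * (c' + e)))"
    using P e(2) \<open>finite J\<close> by (auto simp: decays_at_least_def eventually_ball_finite_distrib)
  moreover have "\<forall>\<^sub>F n in sequentially. card J / e \<le> \<gamma> n"
    using \<gamma> by (simp add: speed_def filterlim_at_top)
  ultimately show "\<forall>\<^sub>F n in sequentially. (\<Sum>j\<in>J. P j n) \<le> exp (- (\<gamma> n * c'))"
  proof eventually_elim
    case (elim n)
    have "(\<Sum>j\<in>J. P j n) \<le> card J * exp (- (\<gamma> n * (c' + e)))"
      using elim(1) by (intro sum_bounded_above) auto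
    also have "\<dots> = card J * exp (- (\<gamma> n * e)) * exp (- (\<gamma> n * c'))"
      by (simp add: distrib_left exp_diff exp_minus field_simps)
    also have "\<dots> \<le> 1 * exp (- (\<gamma> n * c'))"
    proof (rule mult_right_mono)
      have "card J \<le> \<gamma> n * e"
        using elim(2) e(1) by (simp add: field_simps)
      also have "\<dots> \<le> exp (\<gamma> n * e)"
        using exp_ge_add_one_self[of "\<gamma> n * e"] by linarith
      finally show "card J * exp (- (\<gamma> n * e)) \<le> 1"
        by (simp add: exp_minus field_simps)
    qed simp
    finally show ?case by simp
  qed
qed

lemma decays_at_least_add:
  assumes "speed \<gamma>" and "decays_at_least \<gamma> P c" "decays_at_least \<gamma> Q c"
  shows "decays_at_least \<gamma> (\<lambda>n. P n + Q n) c"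
proof -
  have "decays_at_least \<gamma> (case_bool P Q j) c" for j
    using assms by (cases j) auto
  then show ?thesis
    using decays_at_least_sum[OF assms(1), of UNIV "case_bool P Q" c]
    by (simp add: UNIV_bool add.commute)
qed

lemma log_rate_tendsto:
  assumes \<gamma>: "speed \<gamma>" and "\<And>n. 0 \<le> P n"
    and upper: "\<And>c. ereal c < w \<Longrightarrow> decays_at_least \<gamma> P c"
    and lower: "\<And>c. w < ereal c \<Longrightarrow> decays_at_most \<gamma> P c"
  shows "(\<lambda>n. log_ereal (P n) / ereal (\<gamma> n)) \<longlonglongrightarrow> - w"
proof (rule order_tendstoI)
  fix a assume "a < - w"
  then have "w < - a"
    by (metis ereal_less_uminus_reorder)
  then obtain c where c: "w < ereal c" "ereal c < - a"
    using ereal_dense2 by blast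
  from c(2) obtain c' where c': "ereal c < ereal c'" "ereal c' < - a"
    using ereal_dense2 by blast
  from lower[OF c(1)] c'(1) have "\<forall>\<^sub>F n in sequentially. exp (- (\<gamma> n * c')) \<le> P n"
    by (simp add: decays_at_most_def)
  then show "\<forall>\<^sub>F n in sequentially. a < log_ereal (P n) / ereal (\<gamma> n)"
  proof eventually_elim
    case (elim n)
    then have "\<not> P n < exp (\<gamma> n * - c')"
      by simp
    then have "ereal (- c') \<le> log_ereal (P n) / ereal (\<gamma> n)"
      using log_ereal_div_less_iff[OF speed_pos[OF \<gamma>, of n]] linorder_not_less by blast
    moreover have "a < ereal (- c')"
      using c'(2) by (metis ereal_less_uminus_reorder uminus_ereal.simps(1))
    ultimately show ?case by (rule less_le_trans[rotated])
  qed
next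
  fix a assume "- w < a"
  then have "- a < w"
    by (metis ereal_uminus_less_reorder)
  then obtain c where c: "- a < ereal c" "ereal c < w"
    using ereal_dense2 by blast
  from c(1) obtain c' where c': "- a < ereal c'" "ereal c' < ereal c"
    using ereal_dense2 by blast
  from upper[OF c(2)] c'(2) have "\<forall>\<^sub>F n in sequentially. P n \<le> exp (- (\<gamma> n * c'))"
    by (simp add: decays_at_least_def)
  then show "\<forall>\<^sub>F n in sequentially. log_ereal (P n) / ereal (\<gamma> n) < a"
  proof eventually_elim
    case (elim n)
    then have "\<not> exp (\<gamma> n * - c') < P n"
      by simp
    then have "log_ereal (P n) / ereal (\<gamma> n) \<le> ereal (- c')"
      using less_log_ereal_div_iff[OF speed_pos[OF \<gamma>, of n]] linorder_not_less by blast
    moreover have "ereal (- c') < a"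
      using c'(1) by (metis ereal_uminus_less_reorder uminus_ereal.simps(1))
    ultimately show ?case by (rule le_less_trans)
  qed
qed

section \<open>The optimal split between the factors of a product\<close>

text \<open>The zero of the derivative of \<open>y \<mapsto> d y\<^sup>\<theta> + c / y\<^sup>2\<close>.\<close>

definition optimal_scale :: "real \<Rightarrow> real \<Rightarrow> real \<Rightarrow> real" where
  "optimal_scale d \<theta> c = (2 * c / (d * \<theta>)) powr (1 / (\<theta> + 2))"

text \<open>The common factor \<open>(2 c / (d \<theta>)) powr (\<theta> / (\<theta> + 2))\<close> is the value of \<open>y powr \<theta>\<close> at the optimal scale \<open>y\<close>.\<close>

lemma psi_eq:
  assumes "0 < d" "0 < \<theta>" "0 < c"
  shows "psi d \<theta> * c powr (\<theta> / (\<theta> + 2)) =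
    d * (1 + \<theta> / 2) * (2 * c / (d * \<theta>)) powr (\<theta> / (\<theta> + 2))"
proof -
  define a where "a = \<theta> / (\<theta> + 2)"
  have exponent: "2 / (\<theta> + 2) = 1 - a"
    using assms by (simp add: a_def field_simps)
  have "(d * \<theta>) powr (2 / (\<theta> + 2)) = d * \<theta> * (d * \<theta>) powr (- a)"
    unfolding exponent using assms by (simp add: powr_diff powr_minus field_simps)
  moreover have "- \<theta> / (\<theta> + 2) = - a"
    by (simp add: a_def)
  ultimately have "psi d \<theta> = 2 powr a * (d * (1 + \<theta> / 2)) * (d * \<theta>) powr (- a)"
    by (simp add: psi_def a_def[symmetric] algebra_simps)
  moreover have "(2 * c / (d * \<theta>)) powr a = 2 powr a * c powr a * (d * \<theta>) powr (- a)"
    using assms by (simp add: powr_divide powr_mult powr_minus field_simps)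
  ultimately show ?thesis
    by (simp add: a_def[symmetric])
qed

lemma optimal_scale_powr:
  assumes "0 < d" "0 < \<theta>" "0 < c"
  shows "optimal_scale d \<theta> c powr \<theta> = (2 * c / (d * \<theta>)) powr (\<theta> / (\<theta> + 2))"
    and "c / (optimal_scale d \<theta> c)\<^sup>2 = d * \<theta> / 2 * (2 * c / (d * \<theta>)) powr (\<theta> / (\<theta> + 2))"
    and "0 < optimal_scale d \<theta> c"
proof -
  define b where "b = 2 * c / (d * \<theta>)"
  have b: "0 < b"
    using assms by (simp add: b_def)
  show "optimal_scale d \<theta> c powr \<theta> = (2 * c / (d * \<theta>)) powr (\<theta> / (\<theta> + 2))"
    by (simp add: optimal_scale_def powr_powr)
  show "0 < optimal_scale d \<theta> c"
    using assms by (simp add: optimal_scale_def)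
  have "(optimal_scale d \<theta> c)\<^sup>2 = b powr (2 / (\<theta> + 2))"
    using b by (simp add: optimal_scale_def b_def[symmetric] powr_powr flip: powr_realpow)
  also have "2 / (\<theta> + 2) = 1 - \<theta> / (\<theta> + 2)"
    using assms by (simp add: field_simps)
  finally have "c / (optimal_scale d \<theta> c)\<^sup>2 = c / b * b powr (\<theta> / (\<theta> + 2))"
    using b by (simp add: powr_diff)
  also have "c / b = d * \<theta> / 2"
    using assms by (simp add: b_def)
  finally show "c / (optimal_scale d \<theta> c)\<^sup>2 = d * \<theta> / 2 * (2 * c / (d * \<theta>)) powr (\<theta> / (\<theta> + 2))"
    by (simp add: b_def)
qed

lemma psi_attained:
  assumes "0 < d" "0 < \<theta>" "0 < c"
  defines "y \<equiv> optimal_scale d \<theta> c"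
  shows "d * y powr \<theta> + c / y\<^sup>2 = psi d \<theta> * c powr (\<theta> / (\<theta> + 2))"
  using assms by (simp add: psi_eq optimal_scale_powr algebra_simps)

text \<open>In the variable \<open>s = ln (y / z)\<close>, where \<open>z\<close> is the optimal scale, the claim is that
  \<open>exp (\<theta> s) + \<theta>/2 exp (- 2 s) \<ge> 1 + \<theta>/2\<close>. It follows from the tangent lines of the two exponentials at \<open>0\<close>,
  whose slopes cancel.\<close>

lemma psi_le:
  assumes "0 < d" "0 < \<theta>" "0 < c" "0 < y"
  shows "psi d \<theta> * c powr (\<theta> / (\<theta> + 2)) \<le> d * y powr \<theta> + c / y\<^sup>2"
proof -
  define z where "z = optimal_scale d \<theta> c"
  define s where "s = ln (y / z)"
  define B where "B = (2 * c / (d * \<theta>)) powr (\<theta> / (\<theta> + 2))"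
  have z: "0 < z" "z powr \<theta> = B" "c / z\<^sup>2 = d * \<theta> / 2 * B"
    using optimal_scale_powr assms by (simp_all add: z_def B_def)
  have y: "y = z * exp s"
    using z assms by (simp add: s_def)
  have "d * y powr \<theta> + c / y\<^sup>2 = d * (z powr \<theta> * exp (\<theta> * s)) + c / z\<^sup>2 * exp (- 2 * s)"
    using z(1) by (simp add: y powr_mult exp_powr_real power_mult_distrib exp_minus
        mult.commute exp_double[symmetric] divide_simps)
  also have "\<dots> = d * B * (exp (\<theta> * s) + \<theta> / 2 * exp (- 2 * s))"
    by (simp only: z) (simp add: algebra_simps)
  finally have eq: "d * y powr \<theta> + c / y\<^sup>2 = d * B * (exp (\<theta> * s) + \<theta> / 2 * exp (- 2 * s))" .
  have "1 + \<theta> / 2 = (1 + \<theta> * s) + \<theta> / 2 * (1 + - 2 * s)"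
    by (simp add: algebra_simps)
  also have "\<dots> \<le> exp (\<theta> * s) + \<theta> / 2 * exp (- 2 * s)"
    using assms by (intro add_mono mult_left_mono exp_ge_add_one_self) auto
  finally have "d * B * (1 + \<theta> / 2) \<le> d * y powr \<theta> + c / y\<^sup>2"
    unfolding eq using assms by (intro mult_left_mono) (auto simp: B_def)
  then show ?thesis
    using assms by (simp add: psi_eq B_def algebra_simps)
qed

lemma psi_pos: "0 < d \<Longrightarrow> 0 < \<theta> \<Longrightarrow> 0 < psi d \<theta>"
  by (simp add: psi_def add_pos_pos)


text \<open>Here \<open>a y n\<close> and \<open>v u n\<close> are to be read as \<open>P(A\<^sup>n \<ge> y)\<close> and \<open>P(V\<^sup>n \<ge> u)\<close>. The gap between \<open>y\<close> and
  \<open>y'\<close> accounts for the lower bounds of a large deviation principle being available for open sets only; it costs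
  nothing in the limit \<open>y' \<rightarrow> y\<close>.\<close>

lemma product_decays_at_most:
  assumes "0 < d" "0 < \<theta>" "0 < c"
    and a: "\<And>y y'. 0 < y \<Longrightarrow> y < y' \<Longrightarrow> decays_at_most \<gamma> (a y) (d * y' powr \<theta>)"
    and v: "\<And>u u'. 0 < u \<Longrightarrow> u < u' \<Longrightarrow> decays_at_most \<gamma> (v u) (c * u'\<^sup>2)"
    and nonneg: "\<And>y n. 0 \<le> a y n" "\<And>u n. 0 \<le> v u n"
    and split: "\<And>y n. 0 < y \<Longrightarrow> a y n * v (1 / y) n \<le> P n"
  shows "decays_at_most \<gamma> P (psi d \<theta> * c powr (\<theta> / (\<theta> + 2)))" (is "decays_at_most _ _ ?L")
proof (rule decays_at_most_closed)
  fix b assume b: "?L < b"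
  define y where "y = optimal_scale d \<theta> c"
  have y: "0 < y" "d * y powr \<theta> + c / y\<^sup>2 = ?L"
    using optimal_scale_powr(3) psi_attained assms(1-3) by (simp_all add: y_def)
  let ?g = "\<lambda>r. d * (r * y) powr \<theta> + c * (r * (1 / y))\<^sup>2"
  have "(?g \<longlongrightarrow> d * (1 * y) powr \<theta> + c * (1 * (1 / y))\<^sup>2) (at_right 1)"
    using y(1) by (intro tendsto_intros) auto
  then have "(?g \<longlongrightarrow> ?L) (at_right 1)"
    using y by (simp add: power_divide)
  then have "\<forall>\<^sub>F r in at_right 1. ?g r < b"
    using b by (rule order_tendstoD)
  moreover have "\<forall>\<^sub>F r::real in at_right 1. 1 < r"
    by (rule eventually_at_right_less)
  ultimately have "\<forall>\<^sub>F r in at_right 1. ?g r < b \<and> 1 < r"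
    by (rule eventually_conj)
  then obtain r where r: "?g r < b" "1 < r"
    using eventually_happens trivial_limit_at_right_real by blast
  have "decays_at_most \<gamma> (\<lambda>n. a y n * v (1 / y) n) (?g r)"
    using a[of y "r * y"] v[of "1 / y" "r * (1 / y)"] y(1) r(2) nonneg
    by (intro decays_at_most_mult) (auto simp: field_simps)
  then have "decays_at_most \<gamma> P (?g r)"
    using split[OF y(1)] by (rule decays_at_most_mono)
  with r(1) show "\<exists>c'<b. decays_at_most \<gamma> P c'"
    by blast
qed

text \<open>The event \<open>A\<^sup>n V\<^sup>n \<ge> 1\<close> is covered by the events \<open>y\<^sub>j \<le> A\<^sup>n \<le> y\<^sub>j\<^sub>+\<^sub>1\<close>, \<open>V\<^sup>n \<ge> 1 / y\<^sub>j\<^sub>+\<^sub>1\<close>. On a geometric grid of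
  ratio \<open>r\<close> the cost of each of them is within a factor \<open>r\<^sup>2\<close> of the cost of an exact split, and the two ends of the grid can be
  chosen so far out that each of them alone costs at least the optimum.\<close>

lemma product_decays_at_least:
  assumes \<gamma>: "speed \<gamma>" and "0 < d" "0 < \<theta>" "0 < c"
    and a: "\<And>y. 0 < y \<Longrightarrow> decays_at_least \<gamma> (a y) (d * y powr \<theta>)"
    and v: "\<And>u. 0 < u \<Longrightarrow> decays_at_least \<gamma> (v u) (c * u\<^sup>2)"
    and nonneg: "\<And>y n. 0 \<le> a y n" "\<And>u n. 0 \<le> v u n"
    and cover: "\<And>y m n. (\<And>j. 0 < y j) \<Longrightarrow>
      P n \<le> v (1 / y 0) n + a (y m) n + (\<Sum>j<m. a (y j) n * v (1 / y (Suc j)) n)"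
  shows "decays_at_least \<gamma> P (psi d \<theta> * c powr (\<theta> / (\<theta> + 2)))" (is "decays_at_least _ _ ?L")
proof (rule decays_at_least_closed)
  fix b assume b: "b < ?L"
  have L: "0 < ?L"
    using assms psi_pos by simp
  have "((\<lambda>r. ?L / r\<^sup>2) \<longlongrightarrow> ?L / 1\<^sup>2) (at_right 1)"
    by (intro tendsto_intros) auto
  then have "\<forall>\<^sub>F r in at_right 1. b < ?L / r\<^sup>2"
    using b by (intro order_tendstoD) auto
  moreover have "\<forall>\<^sub>F r::real in at_right 1. 1 < r"
    by (rule eventually_at_right_less)
  ultimately have "\<forall>\<^sub>F r in at_right 1. b < ?L / r\<^sup>2 \<and> 1 < r"
    by (rule eventually_conj)
  then obtain r where r: "b < ?L / r\<^sup>2" "1 < r"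
    using eventually_happens trivial_limit_at_right_real by blast
  have r2: "?L / r\<^sup>2 \<le> ?L"
    using L r(2) by (simp add: divide_le_eq mult_le_cancel_left1)
  \<comment> \<open>The smallest grid point is where the second factor alone costs exactly the optimum.\<close>
  define y0 where "y0 = sqrt (c / ?L)"
  have y0: "0 < y0" "c * (1 / y0)\<^sup>2 = ?L"
    using L assms by (simp_all add: y0_def power_divide)
  \<comment> \<open>The number of grid points is such that at the last one the first factor alone costs the optimum.\<close>
  obtain m where m: "(?L / d) powr (1 / \<theta>) / y0 < r ^ m"
    using real_arch_pow r(2) by blast
  define y where "y = (\<lambda>j. y0 * r ^ j)"
  have y: "0 < y j" for j
    using y0 r by (simp add: y_def)
  have large: "?L \<le> d * y m powr \<theta>"
  proof -
    have "(?L / d) powr (1 / \<theta>) \<le> y m"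
      using m y0(1) by (simp add: y_def field_simps)
    then have "((?L / d) powr (1 / \<theta>)) powr \<theta> \<le> y m powr \<theta>"
      using assms by (intro powr_mono2) auto
    also have "((?L / d) powr (1 / \<theta>)) powr \<theta> = ?L / d"
      using assms L by (simp add: powr_powr)
    finally show ?thesis
      using assms by (simp add: field_simps)
  qed
  have middle: "?L / r\<^sup>2 \<le> d * y j powr \<theta> + c * (1 / y (Suc j))\<^sup>2" for j
  proof -
    have "?L / r\<^sup>2 \<le> (d * y j powr \<theta> + c / (y j)\<^sup>2) / r\<^sup>2"
      using psi_le[OF assms(2-4) y[of j]] by (intro divide_right_mono) auto
    also have "\<dots> = d * y j powr \<theta> / r\<^sup>2 + c * (1 / y (Suc j))\<^sup>2"
      by (simp add: y_def power_divide power_mult_distrib add_divide_distrib mult_ac)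
    also have "d * y j powr \<theta> / r\<^sup>2 \<le> d * y j powr \<theta>"
      using divide_left_mono[of 1 "r\<^sup>2" "d * y j powr \<theta>"] r(2) assms(2) by simp
    finally show ?thesis by simp
  qed
  have "decays_at_least \<gamma> (\<lambda>n. v (1 / y 0) n + a (y m) n + (\<Sum>j<m. a (y j) n * v (1 / y (Suc j)) n))
      (?L / r\<^sup>2)"
  proof (intro decays_at_least_add[OF \<gamma>])
    show "decays_at_least \<gamma> (v (1 / y 0)) (?L / r\<^sup>2)"
      by (rule decays_at_least_mono[OF v[of "1 / y 0"] order_refl]) (use y0 r2 in \<open>auto simp: y_def\<close>)
    show "decays_at_least \<gamma> (a (y m)) (?L / r\<^sup>2)"
      by (rule decays_at_least_mono[OF a[OF y[of m]] order_refl]) (use large r2 in simp)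
    show "decays_at_least \<gamma> (\<lambda>n. \<Sum>j<m. a (y j) n * v (1 / y (Suc j)) n) (?L / r\<^sup>2)"
    proof (rule decays_at_least_sum[OF \<gamma>])
      fix j
      have "decays_at_least \<gamma> (\<lambda>n. a (y j) n * v (1 / y (Suc j)) n)
          (d * y j powr \<theta> + c * (1 / y (Suc j))\<^sup>2)"
        by (rule decays_at_least_mult[OF a[OF y] v nonneg]) (simp add: y)
      then show "decays_at_least \<gamma> (\<lambda>n. a (y j) n * v (1 / y (Suc j)) n) (?L / r\<^sup>2)"
        by (rule decays_at_least_mono[OF _ order_refl middle])
    qed simp
  qed
  then have "decays_at_least \<gamma> P (?L / r\<^sup>2)"
    by (rule decays_at_least_mono) (use cover[of y] y in auto)
  with r(1) show "\<exists>c'>b. decays_at_least \<gamma> P c'"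
    by blast
qed

section \<open>Centered normal variables\<close>

lemma (in prob_space) centered_normal_moments:
  assumes "centered_normal M Y"
  shows "Y \<in> borel_measurable M" "integrable M (\<lambda>\<omega>. (Y \<omega>)\<^sup>2)" "expectation Y = 0"
proof -
  show meas[measurable]: "Y \<in> borel_measurable M"
    using assms by (simp add: centered_normal_def)
  have "integrable M (\<lambda>\<omega>. (Y \<omega>)\<^sup>2) \<and> expectation Y = 0"
    using assms[unfolded centered_normal_def, THEN conjunct2]
  proof
    assume ae: "AE \<omega> in M. Y \<omega> = 0"
    then have "AE \<omega> in M. (Y \<omega>)\<^sup>2 = 0"
      by simp
    then have "integrable M (\<lambda>\<omega>. (Y \<omega>)\<^sup>2) \<longleftrightarrow> integrable M (\<lambda>\<omega>. 0 :: real)"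
      by (intro integrable_cong_AE) auto
    moreover have "expectation Y = (\<integral>\<omega>. 0 \<partial>M)"
      using ae by (intro integral_cong_AE) auto
    ultimately show ?thesis by simp
  next
    assume "\<exists>\<sigma>>0. distributed M lborel Y (normal_density 0 \<sigma>)"
    then obtain \<sigma> where \<sigma>: "0 < \<sigma>" and D: "distributed M lborel Y (normal_density 0 \<sigma>)"
      by blast
    have "integrable M (\<lambda>\<omega>. (Y \<omega>)\<^sup>2)"
      using integrable_normal_moment[OF \<sigma>, of 0 2]
        distributed_integrable[OF D, of "\<lambda>x. x\<^sup>2"] by simp
    with normal_distributed_expectation[OF \<sigma> D] show ?thesis
      by simp
  qed
  then show "integrable M (\<lambda>\<omega>. (Y \<omega>)\<^sup>2)" "expectation Y = 0"
    by auto
qed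

text \<open>A normal variable with large standard deviation \<open>\<sigma>\<close> cannot put half of its mass into a small interval, as its
  density is at most \<open>1 / (2 \<sigma>)\<close>.\<close>

lemma (in prob_space) centered_normal_variance_le:
  assumes Y: "centered_normal M Y"
    and K: "0 \<le> K" "1 / 2 \<le> prob {\<omega> \<in> space M. \<bar>Y \<omega>\<bar> \<le> K}"
  shows "expectation (\<lambda>\<omega>. (Y \<omega>)\<^sup>2) \<le> (2 * K)\<^sup>2"
  using Y[unfolded centered_normal_def, THEN conjunct2]
proof
  note [measurable] = centered_normal_moments(1)[OF Y]
  assume "AE \<omega> in M. Y \<omega> = 0"
  then have "expectation (\<lambda>\<omega>. (Y \<omega>)\<^sup>2) = (\<integral>\<omega>. 0 \<partial>M)"
    by (intro integral_cong_AE) auto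
  then show ?thesis by simp
next
  assume "\<exists>\<sigma>>0. distributed M lborel Y (normal_density 0 \<sigma>)"
  then obtain \<sigma> where \<sigma>: "0 < \<sigma>" and D: "distributed M lborel Y (normal_density 0 \<sigma>)"
    by blast
  have density_le: "normal_density 0 \<sigma> y \<le> 1 / (2 * \<sigma>)" for y
  proof -
    have "2 \<le> sqrt (2 * pi)"
      using pi_gt3 by (intro real_le_rsqrt) simp
    then have "2 * \<sigma> \<le> sqrt (2 * pi * \<sigma>\<^sup>2)"
      using \<sigma> by (simp add: real_sqrt_mult)
    then have "1 / sqrt (2 * pi * \<sigma>\<^sup>2) \<le> 1 / (2 * \<sigma>)"
      using \<sigma> by (intro divide_left_mono) auto
    moreover have "exp (- (y - 0)\<^sup>2 / (2 * \<sigma>\<^sup>2)) \<le> 1"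
      by simp
    ultimately have "1 / sqrt (2 * pi * \<sigma>\<^sup>2) * exp (- (y - 0)\<^sup>2 / (2 * \<sigma>\<^sup>2)) \<le> 1 / (2 * \<sigma>) * 1"
      using \<sigma> by (intro mult_mono) auto
    then show ?thesis
      unfolding normal_density_def by simp
  qed
  have "ennreal (prob {\<omega> \<in> space M. \<bar>Y \<omega>\<bar> \<le> K}) = emeasure M (Y -` {- K..K} \<inter> space M)"
    unfolding emeasure_eq_measure by (intro arg_cong[of _ _ ennreal] arg_cong[of _ _ prob]) auto
  also have "\<dots> = (\<integral>\<^sup>+y. ennreal (normal_density 0 \<sigma> y) * indicator {- K..K} y \<partial>lborel)"
    using D by (rule distributed_emeasure) simp
  also have "\<dots> \<le> (\<integral>\<^sup>+y. ennreal (1 / (2 * \<sigma>)) * indicator {- K..K} y \<partial>lborel)"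
    using density_le by (intro nn_integral_mono mult_right_mono ennreal_leI) auto
  also have "\<dots> = ennreal (1 / (2 * \<sigma>)) * ennreal (2 * K)"
    using K(1) by (simp add: nn_integral_cmult_indicator)
  also have "\<dots> = ennreal (K / \<sigma>)"
    using \<sigma> K(1) by (simp add: ennreal_mult[symmetric])
  finally have "prob {\<omega> \<in> space M. \<bar>Y \<omega>\<bar> \<le> K} \<le> K / \<sigma>"
    using \<sigma> K(1) by (subst (asm) ennreal_le_iff) auto
  with K(2) have "1 / 2 \<le> K / \<sigma>"
    by linarith
  then have "\<sigma> \<le> 2 * K"
    using \<sigma> by (simp add: field_simps)
  moreover have "expectation (\<lambda>\<omega>. (Y \<omega>)\<^sup>2) = \<sigma>\<^sup>2"
    using normal_distributed_variance[OF \<sigma> D] normal_distributed_expectation[OF \<sigma> D] by simp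
  ultimately show ?thesis
    using power_mono[of \<sigma> "2 * K" 2] \<sigma> by simp
qed

lemma integrable_product_of_squares:
  fixes f g :: "'a \<Rightarrow> real"
  assumes [measurable]: "f \<in> borel_measurable M" "g \<in> borel_measurable M"
    and "integrable M (\<lambda>x. (f x)\<^sup>2)" "integrable M (\<lambda>x. (g x)\<^sup>2)"
  shows "integrable M (\<lambda>x. f x * g x)"
proof (rule Bochner_Integration.integrable_bound)
  show "integrable M (\<lambda>x. (f x)\<^sup>2 + (g x)\<^sup>2)"
    using assms by simp
  have "\<bar>f x * g x\<bar> \<le> (f x)\<^sup>2 + (g x)\<^sup>2" for x
  proof -
    have "0 \<le> \<bar>f x\<bar> * \<bar>g x\<bar>"
      by simp
    with sum_squares_bound[of "\<bar>f x\<bar>" "\<bar>g x\<bar>"] show ?thesis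
      unfolding abs_mult power2_abs by linarith
  qed
  then show "AE x in M. norm (f x * g x) \<le> norm ((f x)\<^sup>2 + (g x)\<^sup>2)"
    by simp
qed simp

lemma integral_square_diff_expand:
  fixes f g :: "'a \<Rightarrow> real"
  assumes "f \<in> borel_measurable M" "g \<in> borel_measurable M"
    and "integrable M (\<lambda>x. (f x)\<^sup>2)" "integrable M (\<lambda>x. (g x)\<^sup>2)"
  shows "integrable M (\<lambda>x. (f x - s * g x)\<^sup>2)"
    and "(\<integral>x. (f x - s * g x)\<^sup>2 \<partial>M) =
      (\<integral>x. (f x)\<^sup>2 \<partial>M) - 2 * s * (\<integral>x. g x * f x \<partial>M) + s\<^sup>2 * (\<integral>x. (g x)\<^sup>2 \<partial>M)"
proof -
  have eq: "(f x - s * g x)\<^sup>2 = (f x)\<^sup>2 - 2 * s * (g x * f x) + s\<^sup>2 * (g x)\<^sup>2" for x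
    by (simp add: power2_eq_square algebra_simps)
  have int: "integrable M (\<lambda>x. g x * f x)"
    using integrable_product_of_squares[OF assms(2,1,4,3)] .
  show "integrable M (\<lambda>x. (f x - s * g x)\<^sup>2)"
    unfolding eq using int assms by simp
  show "(\<integral>x. (f x - s * g x)\<^sup>2 \<partial>M) =
      (\<integral>x. (f x)\<^sup>2 \<partial>M) - 2 * s * (\<integral>x. g x * f x \<partial>M) + s\<^sup>2 * (\<integral>x. (g x)\<^sup>2 \<partial>M)"
    unfolding eq using int assms by simp
qed

lemma Cauchy_Schwarz_integral:
  fixes f g :: "'a \<Rightarrow> real"
  assumes "f \<in> borel_measurable M" "g \<in> borel_measurable M"
    and "integrable M (\<lambda>x. (f x)\<^sup>2)" "integrable M (\<lambda>x. (g x)\<^sup>2)"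
  shows "(\<integral>x. f x * g x \<partial>M)\<^sup>2 \<le> (\<integral>x. (f x)\<^sup>2 \<partial>M) * (\<integral>x. (g x)\<^sup>2 \<partial>M)"
proof -
  define F where "F = (\<integral>x. (f x)\<^sup>2 \<partial>M)"
  define G where "G = (\<integral>x. (g x)\<^sup>2 \<partial>M)"
  define B where "B = (\<integral>x. g x * f x \<partial>M)"
  have nonneg: "0 \<le> F - 2 * s * B + s\<^sup>2 * G" for s
  proof -
    have "0 \<le> (\<integral>x. (f x - s * g x)\<^sup>2 \<partial>M)"
      by simp
    then show ?thesis
      unfolding integral_square_diff_expand(2)[OF assms] F_def G_def B_def .
  qed
  have "0 \<le> G"
    by (simp add: G_def)
  have "B\<^sup>2 \<le> F * G"
  proof (cases "G = 0")
    case True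
    have "B = 0"
    proof (rule ccontr)
      assume "B \<noteq> 0"
      then show False
        using nonneg[of "(F + 1) / (2 * B)"] True by (simp add: field_simps)
    qed
    with True show ?thesis by simp
  next
    case False
    then have "0 \<le> F - B\<^sup>2 / G"
      using nonneg[of "B / G"] by (simp add: power2_eq_square field_simps)
    then show ?thesis
      using False \<open>0 \<le> G\<close> by (simp add: field_simps)
  qed
  then show ?thesis
    by (simp add: F_def G_def B_def mult.commute)
qed

section \<open>Mean-square continuity of continuous Gaussian processes\<close>

locale gaussian_paths = prob_space M for M :: "'w measure" +
  fixes T :: real and U :: "real \<Rightarrow> 'w \<Rightarrow> real"
  assumes gaussian: "centered_gaussian_process M T U"
    and paths: "continuous_process M T U"
begin

lemma normal_combination:
  "finite J \<Longrightarrow> J \<subseteq> {0..T} \<Longrightarrow> centered_normal M (\<lambda>\<omega>. \<Sum>t\<in>J. c t \<bullet> U t \<omega>)"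
  using gaussian by (simp add: centered_gaussian_process_def)

lemma normal_difference:
  assumes "r \<in> {0..T}" "s \<in> {0..T}"
  shows "centered_normal M (\<lambda>\<omega>. U r \<omega> - U s \<omega>)"
proof (cases "r = s")
  case True
  then show ?thesis by (simp add: centered_normal_def)
next
  case False
  have "centered_normal M (\<lambda>\<omega>. \<Sum>t\<in>{r, s}. (if t = r then 1 else - 1) \<bullet> U t \<omega>)"
    using assms by (intro normal_combination) auto
  with False show ?thesis by simp
qed

lemma normal_U:
  assumes "t \<in> {0..T}"
  shows "centered_normal M (U t)"
proof -
  have "centered_normal M (\<lambda>\<omega>. \<Sum>r\<in>{t}. 1 \<bullet> U r \<omega>)"
    using assms by (intro normal_combination) auto
  then show ?thesis by simp
qed

lemmas measurable_U = centered_normal_moments(1)[OF normal_U]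
lemmas square_integrable_U = centered_normal_moments(2)[OF normal_U]
lemmas mean_U = centered_normal_moments(3)[OF normal_U]

lemma covariance_eq:
  assumes "covariance_function M T U k" "s \<in> {0..T}" "t \<in> {0..T}"
  shows "k s t = expectation (\<lambda>\<omega>. U s \<omega> * U t \<omega>)"
  using assms mean_U by (simp add: covariance_function_def)

text \<open>Path continuity gives convergence in probability of the increments; being centered normal, they then converge
  in mean square by \<open>centered_normal_variance_le\<close>.\<close>

lemma mean_square_continuous:
  assumes s: "s \<in> {0..T}"
  shows "((\<lambda>r. expectation (\<lambda>\<omega>. (U r \<omega> - U s \<omega>)\<^sup>2)) \<longlongrightarrow> 0) (at s within {0..T})"
  unfolding tendsto_at_iff_sequentially comp_def
proof (intro allI impI)
  fix r assume r: "\<forall>i. r i \<in> {0..T} - {s}" "r \<longlonglongrightarrow> s"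
  then have r': "\<And>i. r i \<in> {0..T}" by blast
  note normal = normal_difference[OF r' s]
  note [measurable] = measurable_U[OF s] measurable_U[OF r']
  have small: "(\<lambda>i. prob {\<omega> \<in> space M. \<not> \<bar>U (r i) \<omega> - U s \<omega>\<bar> \<le> e}) \<longlonglongrightarrow> 0" if "0 < e" for e
  proof -
    let ?B = "\<lambda>i. {\<omega> \<in> space M. \<not> \<bar>U (r i) \<omega> - U s \<omega>\<bar> \<le> e}"
    have "(\<lambda>i. \<integral>\<omega>. indicator (?B i) \<omega> \<partial>M) \<longlonglongrightarrow> (\<integral>\<omega>. (0 :: real) \<partial>M)"
    proof (rule integral_dominated_convergence[where w = "\<lambda>_. 1"])
      show "AE \<omega> in M. (\<lambda>i. indicator (?B i) \<omega>) \<longlonglongrightarrow> (0 :: real)"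
      proof (rule AE_I2)
        fix \<omega> assume \<omega>: "\<omega> \<in> space M"
        have "continuous_on {0..T} (\<lambda>t. U t \<omega>)"
          using paths \<omega> by (simp add: continuous_process_def)
        then have "(\<lambda>i. U (r i) \<omega>) \<longlonglongrightarrow> U s \<omega>"
          using r r' s by (auto simp: continuous_on_sequentially comp_def)
        then have "\<forall>\<^sub>F i in sequentially. dist (U (r i) \<omega>) (U s \<omega>) < e"
          using that by (rule tendstoD)
        then have "\<forall>\<^sub>F i in sequentially. indicator (?B i) \<omega> = (0 :: real)"
          by eventually_elim (auto simp: dist_real_def)
        then show "(\<lambda>i. indicator (?B i) \<omega>) \<longlonglongrightarrow> (0 :: real)"
          by (rule tendsto_eventually)
      qed
    qed (auto intro!: AE_I2 simp: indicator_def)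
    then show ?thesis by simp
  qed
  show "(\<lambda>i. expectation (\<lambda>\<omega>. (U (r i) \<omega> - U s \<omega>)\<^sup>2)) \<longlonglongrightarrow> 0"
  proof (rule tendstoI)
    fix e :: real assume "0 < e"
    \<comment> \<open>Any positive \<open>K\<close> with \<open>(2 K)\<^sup>2 < e\<close> would do.\<close>
    define K where "K = sqrt e / 4"
    have K: "0 < K" "(2 * K)\<^sup>2 < e"
      using \<open>0 < e\<close> by (auto simp: K_def power_divide)
    have "\<forall>\<^sub>F i in sequentially. prob {\<omega> \<in> space M. \<not> \<bar>U (r i) \<omega> - U s \<omega>\<bar> \<le> K} < 1 / 2"
      using small[OF K(1)] by (rule order_tendstoD) simp
    then show "\<forall>\<^sub>F i in sequentially. dist (expectation (\<lambda>\<omega>. (U (r i) \<omega> - U s \<omega>)\<^sup>2)) 0 < e"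
    proof eventually_elim
      case (elim i)
      have "{\<omega> \<in> space M. \<bar>U (r i) \<omega> - U s \<omega>\<bar> \<le> K} \<in> events"
        by measurable
      then have "1 / 2 \<le> prob {\<omega> \<in> space M. \<bar>U (r i) \<omega> - U s \<omega>\<bar> \<le> K}"
        using elim prob_neg[of "\<lambda>\<omega>. \<bar>U (r i) \<omega> - U s \<omega>\<bar> \<le> K"] by simp
      then have "expectation (\<lambda>\<omega>. (U (r i) \<omega> - U s \<omega>)\<^sup>2) \<le> (2 * K)\<^sup>2"
        using K(1) by (intro centered_normal_variance_le[OF normal]) auto
      with K(2) show ?case by simp
    qed
  qed
qed

lemma cross_moment_continuous:
  assumes Y: "Y \<in> borel_measurable M" "integrable M (\<lambda>\<omega>. (Y \<omega>)\<^sup>2)"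
  shows "continuous_on {0..T} (\<lambda>r. expectation (\<lambda>\<omega>. U r \<omega> * Y \<omega>))"
  unfolding continuous_on_def
proof
  fix s assume s: "s \<in> {0..T}"
  let ?C = "expectation (\<lambda>\<omega>. (Y \<omega>)\<^sup>2)"
  let ?e = "\<lambda>r. expectation (\<lambda>\<omega>. (U r \<omega> - U s \<omega>)\<^sup>2)"
  have bound: "dist (expectation (\<lambda>\<omega>. U r \<omega> * Y \<omega>)) (expectation (\<lambda>\<omega>. U s \<omega> * Y \<omega>))
      \<le> sqrt (?e r * ?C)" if r: "r \<in> {0..T}" for r
  proof -
    note diff = centered_normal_moments[OF normal_difference[OF r s]]
    have "expectation (\<lambda>\<omega>. U r \<omega> * Y \<omega>) - expectation (\<lambda>\<omega>. U s \<omega> * Y \<omega>) =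
        expectation (\<lambda>\<omega>. U r \<omega> * Y \<omega> - U s \<omega> * Y \<omega>)"
      using r s Y by (intro Bochner_Integration.integral_diff[symmetric]
          integrable_product_of_squares measurable_U square_integrable_U)
    also have "\<dots> = expectation (\<lambda>\<omega>. (U r \<omega> - U s \<omega>) * Y \<omega>)"
      by (simp add: left_diff_distrib)
    finally show ?thesis
      using Cauchy_Schwarz_integral[OF diff(1) Y(1) diff(2) Y(2)]
      by (simp add: dist_real_def real_le_rsqrt)
  qed
  have "((\<lambda>r. sqrt (?e r * ?C)) \<longlongrightarrow> sqrt (0 * ?C)) (at s within {0..T})"
    by (intro tendsto_intros mean_square_continuous s)
  then have "((\<lambda>r. sqrt (?e r * ?C)) \<longlongrightarrow> 0) (at s within {0..T})"
    by simp
  then show "((\<lambda>r. expectation (\<lambda>\<omega>. U r \<omega> * Y \<omega>)) \<longlongrightarrow> expectation (\<lambda>\<omega>. U s \<omega> * Y \<omega>))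
      (at s within {0..T})"
  proof (rule metric_tendsto_imp_tendsto)
    show "\<forall>\<^sub>F r in at s within {0..T}. dist (expectation (\<lambda>\<omega>. U r \<omega> * Y \<omega>))
        (expectation (\<lambda>\<omega>. U s \<omega> * Y \<omega>)) \<le> dist (sqrt (?e r * ?C)) 0"
      unfolding eventually_at_filter using bound by (auto intro!: eventuallyI)
  qed
qed

lemma variance_bounded: "\<exists>C. \<forall>s\<in>{0..T}. expectation (\<lambda>\<omega>. (U s \<omega>)\<^sup>2) \<le> C"
proof -
  have "continuous_on {0..T} (\<lambda>r. expectation (\<lambda>\<omega>. (U r \<omega>)\<^sup>2))"
    unfolding continuous_on_def
  proof
    fix s assume s: "s \<in> {0..T}"
    let ?e = "\<lambda>r. expectation (\<lambda>\<omega>. (U r \<omega> - U s \<omega>)\<^sup>2)"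
    let ?c = "\<lambda>r. expectation (\<lambda>\<omega>. U r \<omega> * U s \<omega>)"
    have eq: "expectation (\<lambda>\<omega>. (U r \<omega>)\<^sup>2) = ?e r + 2 * ?c r - ?c s" if "r \<in> {0..T}" for r
      using integral_square_diff_expand(2)[OF measurable_U[OF that] measurable_U[OF s]
          square_integrable_U[OF that] square_integrable_U[OF s], of 1]
      by (simp add: mult.commute power2_eq_square)
    have "(?c \<longlongrightarrow> ?c s) (at s within {0..T})"
      using cross_moment_continuous[OF measurable_U[OF s] square_integrable_U[OF s]] s
      by (simp add: continuous_on_def)
    then have "((\<lambda>r. ?e r + 2 * ?c r - ?c s) \<longlongrightarrow> 0 + 2 * ?c s - ?c s) (at s within {0..T})"
      by (intro tendsto_intros mean_square_continuous s)
    moreover have "0 + 2 * ?c s - ?c s = expectation (\<lambda>\<omega>. (U s \<omega>)\<^sup>2)"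
      by (simp add: power2_eq_square)
    ultimately show "((\<lambda>r. expectation (\<lambda>\<omega>. (U r \<omega>)\<^sup>2)) \<longlongrightarrow> expectation (\<lambda>\<omega>. (U s \<omega>)\<^sup>2))
        (at s within {0..T})"
      by (auto intro: Lim_transform_eventually simp: eq eventually_at_filter)
  qed
  then have "compact ((\<lambda>r. expectation (\<lambda>\<omega>. (U r \<omega>)\<^sup>2)) ` {0..T})"
    by (intro compact_continuous_image) auto
  then have "bounded ((\<lambda>r. expectation (\<lambda>\<omega>. (U r \<omega>)\<^sup>2)) ` {0..T})"
    by (rule compact_imp_bounded)
  then show ?thesis
    by (fastforce simp: bounded_iff)
qed

end

section \<open>The reproducing kernel Hilbert space\<close>

lemma space_finite_borel_measures: "\<nu> \<in> finite_borel_measures T \<Longrightarrow> space \<nu> = {0..T}"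
  using sets_eq_imp_space_eq[of \<nu> "restrict_space borel {0..T}"]
  by (simp add: finite_borel_measures_def space_restrict_space)

context gaussian_paths
begin

text \<open>By path continuity the process is the pointwise limit of its values at the grid points below the time \<open>s\<close>.\<close>

lemma jointly_measurable:
  assumes \<nu>: "\<nu> \<in> finite_borel_measures T"
  shows "(\<lambda>(s, \<omega>). U s \<omega>) \<in> borel_measurable (\<nu> \<Otimes>\<^sub>M M)"
proof -
  have sets_\<nu>: "sets \<nu> = sets (restrict_space borel {0..T})"
    using \<nu> by (simp add: finite_borel_measures_def)
  note space_\<nu> = space_finite_borel_measures[OF \<nu>]
  have id_meas: "(\<lambda>s. s) \<in> borel_measurable \<nu>"
    unfolding measurable_cong_sets[OF sets_\<nu> refl] by (rule measurable_restrict_space1) simp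
  \<comment> \<open>The process is extended by zero to all times, so that it can be evaluated at all grid points.\<close>
  define V where "V = (\<lambda>s \<omega>. if s \<in> {0..T} then U s \<omega> else 0)"
  have V_meas: "V s \<in> borel_measurable M" for s
    using measurable_U by (cases "s \<in> {0..T}") (auto simp: V_def)
  define grid where "grid = (\<lambda>(m::nat) s. real_of_int \<lfloor>s * (real m + 1)\<rfloor> / (real m + 1))"
  have grid_bounds: "grid m s \<le> s" "s - 1 / (real m + 1) \<le> grid m s" for m s
  proof -
    show "grid m s \<le> s"
      using of_int_floor_le[of "s * (real m + 1)"] by (simp add: grid_def divide_le_eq)
    have "s * (real m + 1) - 1 \<le> real_of_int \<lfloor>s * (real m + 1)\<rfloor>"
      by linarith
    then have "(s * (real m + 1) - 1) / (real m + 1) \<le> grid m s"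
      unfolding grid_def by (intro divide_right_mono) auto
    moreover have "(s * (real m + 1) - 1) / (real m + 1) = s - 1 / (real m + 1)"
      by (simp add: diff_divide_distrib)
    ultimately show "s - 1 / (real m + 1) \<le> grid m s"
      by simp
  qed
  have grid_in: "grid m s \<in> {0..T}" if "s \<in> {0..T}" for m s
    using that grid_bounds(1)[of m s] by (auto simp: grid_def)
  have grid_lim: "(\<lambda>m. grid m s) \<longlonglongrightarrow> s" for s
  proof (rule tendsto_sandwich)
    have "(\<lambda>m. s - 1 / (real m + 1)) \<longlonglongrightarrow> s - 0"
      using LIMSEQ_inverse_real_of_nat
      by (intro tendsto_intros) (simp add: inverse_eq_divide add.commute)
    then show "(\<lambda>m. s - 1 / (real m + 1)) \<longlonglongrightarrow> s"
      by simp
  qed (use grid_bounds in auto)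
  have "(\<lambda>x. V (fst x) (snd x)) \<in> borel_measurable (\<nu> \<Otimes>\<^sub>M M)"
  proof (rule borel_measurable_LIMSEQ_metric)
    fix m
    have "(\<lambda>x. V (real_of_int \<lfloor>fst x * (real m + 1)\<rfloor> / (real m + 1)) (snd x))
        \<in> borel_measurable (\<nu> \<Otimes>\<^sub>M M)"
    proof (rule measurable_compose_countable[where f = "\<lambda>i x. V (real_of_int i / (real m + 1)) (snd x)"])
      show "(\<lambda>x. V (real_of_int i / (real m + 1)) (snd x)) \<in> borel_measurable (\<nu> \<Otimes>\<^sub>M M)" for i
        using V_meas by measurable
      have "(\<lambda>x. fst x * (real m + 1)) \<in> borel_measurable (\<nu> \<Otimes>\<^sub>M M)"
        using measurable_compose[OF measurable_fst id_meas] by measurable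
      then show "(\<lambda>x. \<lfloor>fst x * (real m + 1)\<rfloor>) \<in> measurable (\<nu> \<Otimes>\<^sub>M M) (count_space UNIV)"
        by measurable
    qed
    then show "(\<lambda>x. V (grid m (fst x)) (snd x)) \<in> borel_measurable (\<nu> \<Otimes>\<^sub>M M)"
      by (simp add: grid_def)
  next
    fix x assume "x \<in> space (\<nu> \<Otimes>\<^sub>M M)"
    then have x: "fst x \<in> {0..T}" "snd x \<in> space M"
      by (auto simp: space_pair_measure space_\<nu>)
    then have "continuous_on {0..T} (\<lambda>t. U t (snd x))"
      using paths by (simp add: continuous_process_def)
    then have "(\<lambda>m. U (grid m (fst x)) (snd x)) \<longlonglongrightarrow> U (fst x) (snd x)"
      using grid_lim x(1) grid_in[OF x(1)]
      by (intro continuous_on_tendsto_compose[where f = "\<lambda>t. U t (snd x)"]) auto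
    then show "(\<lambda>m. V (grid m (fst x)) (snd x)) \<longlonglongrightarrow> V (fst x) (snd x)"
      using grid_in[OF x(1)] x(1) by (simp add: V_def)
  qed
  then show ?thesis
    by (rule measurable_cong[THEN iffD1, rotated])
       (auto simp: space_pair_measure space_\<nu> V_def)
qed

lemma Fubini_path_integral:
  assumes \<nu>: "\<nu> \<in> finite_borel_measures T"
    and D[measurable]: "D \<in> borel_measurable M" and D2: "integrable M (\<lambda>\<omega>. (D \<omega>)\<^sup>2)"
  shows "(\<lambda>\<omega>. \<integral>s. U s \<omega> \<partial>\<nu>) \<in> borel_measurable M"
    and "integrable M (\<lambda>\<omega>. D \<omega> * (\<integral>s. U s \<omega> \<partial>\<nu>))"
    and "expectation (\<lambda>\<omega>. D \<omega> * (\<integral>s. U s \<omega> \<partial>\<nu>)) = (\<integral>s. expectation (\<lambda>\<omega>. U s \<omega> * D \<omega>) \<partial>\<nu>)"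
proof -
  interpret \<nu>: finite_measure \<nu>
    using \<nu> by (simp add: finite_borel_measures_def)
  interpret P: pair_sigma_finite \<nu> M ..
  interpret Q: pair_sigma_finite M \<nu> ..
  note space_\<nu> = space_finite_borel_measures[OF \<nu>]
  note [measurable] = jointly_measurable[OF \<nu>]
  have swap[measurable]: "(\<lambda>(\<omega>, s). U s \<omega>) \<in> borel_measurable (M \<Otimes>\<^sub>M \<nu>)"
    using measurable_pair_swap[OF jointly_measurable[OF \<nu>]] by simp
  show "(\<lambda>\<omega>. \<integral>s. U s \<omega> \<partial>\<nu>) \<in> borel_measurable M"
    by measurable
  obtain C where C: "\<And>s. s \<in> {0..T} \<Longrightarrow> expectation (\<lambda>\<omega>. (U s \<omega>)\<^sup>2) \<le> C"
    using variance_bounded by blast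
  have int_s: "integrable M (\<lambda>\<omega>. U s \<omega> * D \<omega>)" if "s \<in> {0..T}" for s
    using that D D2 by (intro integrable_product_of_squares measurable_U square_integrable_U)
  have int: "integrable (\<nu> \<Otimes>\<^sub>M M) (\<lambda>(s, \<omega>). U s \<omega> * D \<omega>)"
  proof (rule P.Fubini_integrable)
    show "(\<lambda>(s, \<omega>). U s \<omega> * D \<omega>) \<in> borel_measurable (\<nu> \<Otimes>\<^sub>M M)"
      by measurable
    show "AE s in \<nu>. integrable M (\<lambda>\<omega>. case (s, \<omega>) of (s, \<omega>) \<Rightarrow> U s \<omega> * D \<omega>)"
      using int_s by (intro AE_I2) (simp add: space_\<nu>)
    have "(\<integral>\<omega>. norm (U s \<omega> * D \<omega>) \<partial>M) \<le> C + expectation (\<lambda>\<omega>. (D \<omega>)\<^sup>2)" if "s \<in> {0..T}" for s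
    proof -
      have "norm (U s \<omega> * D \<omega>) \<le> (U s \<omega>)\<^sup>2 + (D \<omega>)\<^sup>2" for \<omega>
      proof -
        have "0 \<le> \<bar>U s \<omega>\<bar> * \<bar>D \<omega>\<bar>"
          by simp
        with sum_squares_bound[of "\<bar>U s \<omega>\<bar>" "\<bar>D \<omega>\<bar>"] show ?thesis
          unfolding abs_mult power2_abs real_norm_def by linarith
      qed
      then have "(\<integral>\<omega>. norm (U s \<omega> * D \<omega>) \<partial>M) \<le> (\<integral>\<omega>. (U s \<omega>)\<^sup>2 + (D \<omega>)\<^sup>2 \<partial>M)"
        using that D2 int_s square_integrable_U by (intro integral_mono) auto
      with C[OF that] show ?thesis
        using D2 square_integrable_U[OF that] by simp
    qed
    then show "integrable \<nu> (\<lambda>s. \<integral>\<omega>. norm (case (s, \<omega>) of (s, \<omega>) \<Rightarrow> U s \<omega> * D \<omega>) \<partial>M)"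
      by (intro \<nu>.integrable_const_bound[where B = "C + expectation (\<lambda>\<omega>. (D \<omega>)\<^sup>2)"] AE_I2)
         (auto simp: space_\<nu>)
  qed
  then have int': "integrable (M \<Otimes>\<^sub>M \<nu>) (\<lambda>(\<omega>, s). U s \<omega> * D \<omega>)"
    using P.integrable_product_swap[OF int] by simp
  show "integrable M (\<lambda>\<omega>. D \<omega> * (\<integral>s. U s \<omega> \<partial>\<nu>))"
    using Q.integrable_fst'[OF int'] by (simp add: mult.commute)
  show "expectation (\<lambda>\<omega>. D \<omega> * (\<integral>s. U s \<omega> \<partial>\<nu>)) = (\<integral>s. expectation (\<lambda>\<omega>. U s \<omega> * D \<omega>) \<partial>\<nu>)"
    using P.Fubini_integral[OF int] by (simp add: mult.commute)
qed

lemma gaussian_space_L2: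
  assumes "Y \<in> gaussian_space M T U"
  shows "Y \<in> borel_measurable M" "integrable M (\<lambda>\<omega>. (Y \<omega>)\<^sup>2)"
  using assms by (auto simp: gaussian_space_def L2_closure_def)

text \<open>By Fubini's theorem \<open>D\<close> is orthogonal to every path integral, and orthogonality passes to limits in mean square.
  Consequently two elements of the Gaussian space with the same image under \<open>rkhs_map\<close> have the same norm.\<close>

lemma orthogonal_to_closure:
  assumes D: "D \<in> borel_measurable M" "integrable M (\<lambda>\<omega>. (D \<omega>)\<^sup>2)"
    and orth: "\<And>s. s \<in> {0..T} \<Longrightarrow> expectation (\<lambda>\<omega>. U s \<omega> * D \<omega>) = 0"
    and Y: "Y \<in> gaussian_space M T U"
  shows "expectation (\<lambda>\<omega>. D \<omega> * Y \<omega>) = 0"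
proof -
  note Y' = gaussian_space_L2[OF Y]
  let ?C = "expectation (\<lambda>\<omega>. (D \<omega>)\<^sup>2)"
  have path_integral_0: "expectation (\<lambda>\<omega>. D \<omega> * (\<integral>s. U s \<omega> \<partial>\<nu>)) = 0"
    if \<nu>: "\<nu> \<in> finite_borel_measures T" for \<nu>
  proof -
    have "(\<integral>s. expectation (\<lambda>\<omega>. U s \<omega> * D \<omega>) \<partial>\<nu>) = (\<integral>s. 0 \<partial>\<nu>)"
      using orth space_finite_borel_measures[OF \<nu>]
      by (intro Bochner_Integration.integral_cong) auto
    with Fubini_path_integral(3)[OF \<nu> D] show ?thesis by simp
  qed
  have le: "(expectation (\<lambda>\<omega>. D \<omega> * Y \<omega>))\<^sup>2 \<le> ?C * e" if "0 < e" for e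
  proof -
    obtain V where V: "V \<in> signed_integrals T U" "integrable M (\<lambda>\<omega>. (Y \<omega> - V \<omega>)\<^sup>2)"
        "expectation (\<lambda>\<omega>. (Y \<omega> - V \<omega>)\<^sup>2) < e"
      using Y \<open>0 < e\<close> by (auto simp: gaussian_space_def L2_closure_def)
    then obtain \<nu>1 \<nu>2 where \<nu>: "\<nu>1 \<in> finite_borel_measures T" "\<nu>2 \<in> finite_borel_measures T"
      and V_eq: "V = (\<lambda>\<omega>. (\<integral>t. U t \<omega> \<partial>\<nu>1) - (\<integral>t. U t \<omega> \<partial>\<nu>2))"
      unfolding signed_integrals_def by blast
    have V_meas: "V \<in> borel_measurable M"
      unfolding V_eq using Fubini_path_integral(1)[OF \<nu>(1) D] Fubini_path_integral(1)[OF \<nu>(2) D]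
      by (rule borel_measurable_diff)
    have DV: "integrable M (\<lambda>\<omega>. D \<omega> * V \<omega>)" "expectation (\<lambda>\<omega>. D \<omega> * V \<omega>) = 0"
      using Fubini_path_integral(2)[OF \<nu>(1) D] Fubini_path_integral(2)[OF \<nu>(2) D]
        path_integral_0[OF \<nu>(1)] path_integral_0[OF \<nu>(2)]
      unfolding V_eq right_diff_distrib by simp_all
    have "expectation (\<lambda>\<omega>. D \<omega> * Y \<omega>) = expectation (\<lambda>\<omega>. D \<omega> * (Y \<omega> - V \<omega>))"
      using DV integrable_product_of_squares[OF D(1) Y'(1) D(2) Y'(2)]
      by (simp add: right_diff_distrib)
    then have "(expectation (\<lambda>\<omega>. D \<omega> * Y \<omega>))\<^sup>2 \<le> ?C * expectation (\<lambda>\<omega>. (Y \<omega> - V \<omega>)\<^sup>2)"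
      using Cauchy_Schwarz_integral[OF D(1) borel_measurable_diff[OF Y'(1) V_meas] D(2) V(2)]
      by simp
    also have "\<dots> \<le> ?C * e"
      using V(3) by (intro mult_left_mono) auto
    finally show ?thesis .
  qed
  have "((\<lambda>e. ?C * e) \<longlongrightarrow> ?C * 0) (at_right 0)"
    by (intro tendsto_intros)
  moreover have "\<forall>\<^sub>F e in at_right 0. (expectation (\<lambda>\<omega>. D \<omega> * Y \<omega>))\<^sup>2 \<le> ?C * e"
    using eventually_at_right_less[of 0] by eventually_elim (rule le)
  ultimately have "(expectation (\<lambda>\<omega>. D \<omega> * Y \<omega>))\<^sup>2 \<le> ?C * 0"
    by (rule tendsto_lowerbound) simp
  then show ?thesis by simp
qed

text \<open>The value at \<open>t\<close> is the path integral against the point mass at \<open>t\<close>.\<close>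

lemma scaled_point_in_gaussian_space:
  assumes t: "t \<in> {0..T}" and c: "0 \<le> c"
  shows "(\<lambda>\<omega>. c * U t \<omega>) \<in> gaussian_space M T U"
proof -
  let ?R = "restrict_space borel {0..T} :: real measure"
  let ?\<nu> = "\<lambda>a::real. density (return ?R t) (\<lambda>_. ennreal a)"
  have space_R: "space ?R = {0..T}"
    by (simp add: space_restrict_space)
  have \<nu>: "?\<nu> a \<in> finite_borel_measures T" if "0 \<le> a" for a
    unfolding finite_borel_measures_def
  proof (intro CollectI conjI finite_measureI)
    have "emeasure (?\<nu> a) (space (?\<nu> a)) = ennreal a * emeasure (return ?R t) (space ?R)"
      unfolding space_density space_return
      by (rule emeasure_density_const) (simp only: sets_return sets.top)
    moreover have "emeasure (return ?R t) (space ?R) = 1"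
      using prob_space.emeasure_space_1[OF prob_space_return[of t ?R]] t by (simp add: space_R)
    ultimately show "emeasure (?\<nu> a) (space (?\<nu> a)) \<noteq> \<infinity>"
      by simp
  qed simp
  have integral: "(\<integral>s. U s \<omega> \<partial>?\<nu> a) = a * U t \<omega>" if a: "0 \<le> a" and \<omega>: "\<omega> \<in> space M" for a \<omega>
  proof -
    have meas[measurable]: "(\<lambda>s. U s \<omega>) \<in> borel_measurable ?R"
      using paths \<omega> by (intro borel_measurable_continuous_on_restrict) (simp add: continuous_process_def)
    have "(\<integral>s. U s \<omega> \<partial>?\<nu> a) = (\<integral>s. a *\<^sub>R U s \<omega> \<partial>return ?R t)"
      using a by (intro integral_density) auto
    also have "\<dots> = a *\<^sub>R U t \<omega>"
      using t by (intro integral_return) (auto simp: space_R)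
    finally show ?thesis by simp
  qed
  define V where "V = (\<lambda>\<omega>. (\<integral>s. U s \<omega> \<partial>?\<nu> c) - (\<integral>s. U s \<omega> \<partial>?\<nu> 0))"
  have V: "V \<in> signed_integrals T U"
    using \<nu>[OF c] \<nu>[OF order_refl] unfolding signed_integrals_def V_def by blast
  have V_eq: "V \<omega> = c * U t \<omega>" if "\<omega> \<in> space M" for \<omega>
    using integral[OF c that] integral[OF order_refl that] by (simp add: V_def)
  have "(\<integral>\<omega>. (c * U t \<omega> - V \<omega>)\<^sup>2 \<partial>M) = (\<integral>\<omega>. 0 \<partial>M)"
    by (intro Bochner_Integration.integral_cong) (auto simp: V_eq)
  moreover have "integrable M (\<lambda>\<omega>. (c * U t \<omega> - V \<omega>)\<^sup>2) \<longleftrightarrow> integrable M (\<lambda>\<omega>. 0 :: real)"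
    by (intro Bochner_Integration.integrable_cong) (auto simp: V_eq)
  ultimately show ?thesis
    using V measurable_U[OF t] square_integrable_U[OF t]
    unfolding gaussian_space_def L2_closure_def
    by (auto simp: power_mult_distrib intro!: bexI[of _ V])
qed

text \<open>Hides the choice of a preimage in the definition of the norm.\<close>

lemma rkhs_representer:
  assumes "h \<in> rkhs M T U"
  obtains Y where "Y \<in> gaussian_space M T U" "rkhs_map M T U Y = h"
    and "(rkhs_norm M T U h)\<^sup>2 = expectation (\<lambda>\<omega>. (Y \<omega>)\<^sup>2)"
proof
  let ?Y = "inv_into (gaussian_space M T U) (rkhs_map M T U) h"
  show "?Y \<in> gaussian_space M T U" "rkhs_map M T U ?Y = h"
    using assms by (auto simp: rkhs_def inv_into_into f_inv_into_f)
  show "(rkhs_norm M T U h)\<^sup>2 = expectation (\<lambda>\<omega>. (?Y \<omega>)\<^sup>2)"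
    by (simp add: rkhs_norm_def rkhs_inner_def power2_eq_square[symmetric])
qed

text \<open>This is boundedness of evaluation at \<open>t\<close>, obtained from \<open>0 \<le> E(Y - a U(t))\<^sup>2\<close>. Keeping \<open>a\<close> free instead of
  optimizing it avoids division by the variance, and lets the inequality be summed over the components of a
  vector-valued process, with the multiplier \<open>a \<xi>\<^sub>i\<close> in component \<open>i\<close>.\<close>

lemma rkhs_norm_lower_bound:
  assumes h: "h \<in> rkhs M T U" and t: "t \<in> {0..T}"
  shows "a * h t - a\<^sup>2 / 2 * expectation (\<lambda>\<omega>. (U t \<omega>)\<^sup>2) \<le> 1 / 2 * (rkhs_norm M T U h)\<^sup>2"
proof -
  obtain Y where Y: "Y \<in> gaussian_space M T U" "rkhs_map M T U Y = h"
    "(rkhs_norm M T U h)\<^sup>2 = expectation (\<lambda>\<omega>. (Y \<omega>)\<^sup>2)"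
    using rkhs_representer[OF h] .
  have "h t = expectation (\<lambda>\<omega>. U t \<omega> * Y \<omega>)"
    using t by (simp flip: Y(2) add: rkhs_map_def)
  moreover have "0 \<le> expectation (\<lambda>\<omega>. (Y \<omega> - a * U t \<omega>)\<^sup>2)"
    by simp
  ultimately show ?thesis
    using integral_square_diff_expand(2)[OF gaussian_space_L2(1)[OF Y(1)] measurable_U[OF t]
        gaussian_space_L2(2)[OF Y(1)] square_integrable_U[OF t], of a]
    by (simp add: Y(3))
qed

text \<open>The multiple \<open>c U(t)\<close> is one preimage of \<open>h\<close>, but the norm is defined by another one, \<open>Y\<close>. The difference is
  orthogonal to \<open>Y\<close> itself, so the square of \<open>Y\<close> has the expectation \<open>c E(U(t) Y)\<close>, which is a value of \<open>h\<close>.\<close>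

lemma rkhs_kernel_section:
  assumes t: "t \<in> {0..T}" and c: "0 \<le> c"
  defines "h \<equiv> (\<lambda>s\<in>{0..T}. c * expectation (\<lambda>\<omega>. U s \<omega> * U t \<omega>))"
  shows "h \<in> rkhs M T U" and "(rkhs_norm M T U h)\<^sup>2 = c\<^sup>2 * expectation (\<lambda>\<omega>. (U t \<omega>)\<^sup>2)"
    and "continuous_on {0..T} h"
proof -
  let ?cU = "\<lambda>\<omega>. c * U t \<omega>"
  note cU = scaled_point_in_gaussian_space[OF t c]
  have h: "h = rkhs_map M T U ?cU"
    by (auto simp: h_def rkhs_map_def mult.left_commute)
  show mem: "h \<in> rkhs M T U"
    unfolding h rkhs_def using cU by (rule imageI)
  have "continuous_on {0..T} (\<lambda>s. c * expectation (\<lambda>\<omega>. U s \<omega> * U t \<omega>))"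
    by (intro continuous_intros cross_moment_continuous measurable_U square_integrable_U t)
  then show "continuous_on {0..T} h"
    by (rule continuous_on_cong[THEN iffD1, rotated 2]) (auto simp: h_def)
  obtain Y where Y: "Y \<in> gaussian_space M T U" "rkhs_map M T U Y = h"
    "(rkhs_norm M T U h)\<^sup>2 = expectation (\<lambda>\<omega>. (Y \<omega>)\<^sup>2)"
    using rkhs_representer[OF mem] .
  note Y' = gaussian_space_L2[OF Y(1)]
  note cU' = gaussian_space_L2[OF cU]
  let ?D = "\<lambda>\<omega>. Y \<omega> - 1 * ?cU \<omega>"
  have UY: "expectation (\<lambda>\<omega>. U s \<omega> * Y \<omega>) = c * expectation (\<lambda>\<omega>. U s \<omega> * U t \<omega>)"
    if "s \<in> {0..T}" for s
    using fun_cong[OF Y(2), of s] that by (simp add: rkhs_map_def h_def)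
  have orth: "expectation (\<lambda>\<omega>. U s \<omega> * ?D \<omega>) = 0" if s: "s \<in> {0..T}" for s
  proof -
    have "expectation (\<lambda>\<omega>. U s \<omega> * ?D \<omega>) =
        expectation (\<lambda>\<omega>. U s \<omega> * Y \<omega>) - expectation (\<lambda>\<omega>. U s \<omega> * ?cU \<omega>)"
      using integrable_product_of_squares[OF measurable_U[OF s] Y'(1) square_integrable_U[OF s] Y'(2)]
        integrable_product_of_squares[OF measurable_U[OF s] cU'(1) square_integrable_U[OF s] cU'(2)]
      by (simp add: right_diff_distrib)
    then show ?thesis
      using UY[OF s] by (simp add: mult.left_commute)
  qed
  have "expectation (\<lambda>\<omega>. ?D \<omega> * Y \<omega>) = 0"
    by (rule orthogonal_to_closure[OF _ integral_square_diff_expand(1)[OF Y'(1) cU'(1) Y'(2) cU'(2)]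
          orth Y(1)]) (use Y'(1) cU'(1) in measurable)
  moreover have "expectation (\<lambda>\<omega>. ?D \<omega> * Y \<omega>) =
      expectation (\<lambda>\<omega>. (Y \<omega>)\<^sup>2) - c * expectation (\<lambda>\<omega>. U t \<omega> * Y \<omega>)"
    using integrable_product_of_squares[OF measurable_U[OF t] Y'(1) square_integrable_U[OF t] Y'(2)] Y'(2)
    by (simp add: left_diff_distrib power2_eq_square mult.assoc)
  ultimately show "(rkhs_norm M T U h)\<^sup>2 = c\<^sup>2 * expectation (\<lambda>\<omega>. (U t \<omega>)\<^sup>2)"
    using UY[OF t] Y(3) by (simp add: power2_eq_square mult.assoc)
qed

end

section \<open>Level crossing of continuous paths\<close>

lemma topspace_path_topology:
  fixes h :: "real \<Rightarrow> 'b::metric_space"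
  shows "h \<in> topspace (path_topology T) \<longleftrightarrow> h \<in> extensional {0..T} \<and> continuous_on {0..T} h"
proof -
  have "bounded (h ` {0..T})" if "continuous_on {0..T} h"
    using that by (intro compact_imp_bounded compact_continuous_image) auto
  then show ?thesis
    by (auto simp: path_topology_def)
qed

text \<open>Replaces balls of the supremum metric by pointwise bounds on \<open>[0,T]\<close>.\<close>

lemma openin_path_topologyI:
  fixes S :: "(real \<Rightarrow> 'b::metric_space) set"
  assumes T: "0 \<le> T" and S: "S \<subseteq> topspace (path_topology T)"
    and inner: "\<And>h. h \<in> S \<Longrightarrow>
      \<exists>r>0. \<forall>g\<in>topspace (path_topology T). (\<forall>t\<in>{0..T}. dist (h t) (g t) \<le> r) \<longrightarrow> g \<in> S"
  shows "openin (path_topology T) S"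
proof -
  define m :: "(real \<Rightarrow> 'b) metric" where "m = cfunspace (top_of_set {0..T}) euclidean_metric"
  interpret Metric_space "mspace m" "mdist m"
    by (rule Metric_space_mspace_mdist)
  have E: "path_topology T = mtopology_of m"
    by (simp add: path_topology_def m_def)
  have top: "topspace (path_topology T) = mspace m"
    by (simp only: E topspace_mtopology_of)
  have "\<exists>r>0. mball h r \<subseteq> S" if h: "h \<in> S" for h
  proof -
    from inner[OF h] obtain r where r: "0 < r"
      "\<And>g. g \<in> mspace m \<Longrightarrow> (\<forall>t\<in>{0..T}. dist (h t) (g t) \<le> r) \<Longrightarrow> g \<in> S"
      unfolding top by blast
    have "g \<in> S" if g: "g \<in> mball h r" for g
    proof (rule r(2))
      from g have *: "h \<in> mspace m" "g \<in> mspace m" "mdist m h g \<le> r"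
        unfolding in_mball by auto
      then show "g \<in> mspace m" by blast
      show "\<forall>t\<in>{0..T}. dist (h t) (g t) \<le> r"
        using * cfunspace_mdist_le[of h "top_of_set {0..T}" euclidean_metric g r] T
        unfolding m_def by (simp del: mspace_cfunspace)
    qed
    with r(1) show ?thesis by blast
  qed
  then show ?thesis
    unfolding E mtopology_of_def openin_mtopology using S[unfolded top] by blast
qed

lemma openin_level_crossing:
  fixes \<xi> :: "'b::euclidean_space" and v :: "real \<Rightarrow> real"
  assumes T: "0 \<le> T"
  shows "openin (path_topology T) {h \<in> topspace (path_topology T). \<exists>t\<in>{0..T}. v t < h t \<bullet> \<xi>}"
proof (rule openin_path_topologyI[OF T])
  fix h :: "real \<Rightarrow> 'b"
  assume "h \<in> {h \<in> topspace (path_topology T). \<exists>t\<in>{0..T}. v t < h t \<bullet> \<xi>}"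
  then obtain t where t: "t \<in> {0..T}" "v t < h t \<bullet> \<xi>"
    by blast
  define r where "r = (h t \<bullet> \<xi> - v t) / (1 + norm \<xi>)"
  have pos: "0 < 1 + norm \<xi>"
    using norm_ge_zero[of \<xi>] by linarith
  then have r: "0 < r" "r * (1 + norm \<xi>) = h t \<bullet> \<xi> - v t"
    using t(2) by (simp_all add: r_def)
  have "v t < g t \<bullet> \<xi>" if "dist (h t) (g t) \<le> r" for g
  proof -
    have "h t \<bullet> \<xi> - g t \<bullet> \<xi> \<le> norm (h t - g t) * norm \<xi>"
      by (metis inner_diff_left norm_cauchy_schwarz)
    also have "\<dots> \<le> r * norm \<xi>"
      using that by (intro mult_right_mono) (auto simp: dist_norm)
    also have "\<dots> < h t \<bullet> \<xi> - v t"
      using r by (simp add: algebra_simps)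
    finally show ?thesis by simp
  qed
  with r(1) t(1) show "\<exists>r>0. \<forall>g\<in>topspace (path_topology T). (\<forall>t\<in>{0..T}. dist (h t) (g t) \<le> r) \<longrightarrow>
      g \<in> {h \<in> topspace (path_topology T). \<exists>t\<in>{0..T}. v t < h t \<bullet> \<xi>}"
    by blast
qed blast

text \<open>A path that stays below the level does so with a positive margin, by compactness of \<open>[0,T]\<close>.\<close>

lemma closedin_level_crossing:
  fixes \<xi> :: "'b::euclidean_space" and v :: "real \<Rightarrow> real"
  assumes T: "0 \<le> T" and v: "continuous_on {0..T} v"
  shows "closedin (path_topology T) {h \<in> topspace (path_topology T). \<exists>t\<in>{0..T}. v t \<le> h t \<bullet> \<xi>}"
    (is "closedin ?E ?C")
  unfolding closedin_def
proof
  show "openin ?E (topspace ?E - ?C)"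
  proof (rule openin_path_topologyI[OF T])
    fix h assume "h \<in> topspace ?E - ?C"
    then have h: "h \<in> topspace ?E" "\<And>t. t \<in> {0..T} \<Longrightarrow> h t \<bullet> \<xi> < v t"
      by (auto simp: not_le)
    from h(1) have "continuous_on {0..T} (\<lambda>t. v t - h t \<bullet> \<xi>)"
      by (intro continuous_intros v) (simp add: topspace_path_topology)
    then obtain s where s: "s \<in> {0..T}" "\<And>t. t \<in> {0..T} \<Longrightarrow> v s - h s \<bullet> \<xi> \<le> v t - h t \<bullet> \<xi>"
      using T continuous_attains_inf[of "{0..T}" "\<lambda>t. v t - h t \<bullet> \<xi>"] by auto
    define r where "r = (v s - h s \<bullet> \<xi>) / (1 + norm \<xi>)"
    have pos: "0 < 1 + norm \<xi>"
      using norm_ge_zero[of \<xi>] by linarith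
    then have r: "0 < r" "r * (1 + norm \<xi>) = v s - h s \<bullet> \<xi>"
      using h(2)[OF s(1)] by (simp_all add: r_def)
    have "g t \<bullet> \<xi> < v t" if "t \<in> {0..T}" "dist (h t) (g t) \<le> r" for g t
    proof -
      have "g t \<bullet> \<xi> - h t \<bullet> \<xi> \<le> norm (g t - h t) * norm \<xi>"
        by (metis inner_diff_left norm_cauchy_schwarz)
      also have "\<dots> \<le> r * norm \<xi>"
        using that by (intro mult_right_mono) (auto simp: dist_norm norm_minus_commute)
      also have "\<dots> < v s - h s \<bullet> \<xi>"
        using r by (simp add: algebra_simps)
      also have "\<dots> \<le> v t - h t \<bullet> \<xi>"
        using s(2) that by blast
      finally show ?thesis by simp
    qed
    then have "g \<in> topspace ?E - ?C" if "g \<in> topspace ?E" "\<forall>t\<in>{0..T}. dist (h t) (g t) \<le> r" for g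
      using that by (auto simp: not_le)
    with r(1) show "\<exists>r>0. \<forall>g\<in>topspace ?E. (\<forall>t\<in>{0..T}. dist (h t) (g t) \<le> r) \<longrightarrow> g \<in> topspace ?E - ?C"
      by blast
  qed blast
qed blast

text \<open>By continuity and compactness the level is reached if and only if it is almost reached, up to every positive tolerance, on a
  countable dense set of times.\<close>

lemma level_crossing_measurable:
  fixes Y :: "real \<Rightarrow> 'w \<Rightarrow> real"
  assumes meas: "\<And>t. t \<in> {0..T} \<Longrightarrow> Y t \<in> borel_measurable N"
    and cont: "\<And>\<omega>. \<omega> \<in> space N \<Longrightarrow> continuous_on {0..T} (\<lambda>t. Y t \<omega>)"
  shows "{\<omega> \<in> space N. \<exists>t\<in>{0..T}. 0 \<le> Y t \<omega>} \<in> sets N"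
proof -
  obtain D where D: "countable D" "D \<subseteq> {0..T}" "{0..T} \<subseteq> closure D"
    using separable[of "{0..T}"] by blast
  have "(\<exists>t\<in>{0..T}. 0 \<le> Y t \<omega>) \<longleftrightarrow> (\<forall>m. \<exists>q\<in>D. - inverse (real (Suc m)) < Y q \<omega>)"
    if \<omega>: "\<omega> \<in> space N" for \<omega>
  proof
    assume "\<exists>t\<in>{0..T}. 0 \<le> Y t \<omega>"
    then obtain t where t: "t \<in> {0..T}" "0 \<le> Y t \<omega>"
      by blast
    show "\<forall>m. \<exists>q\<in>D. - inverse (real (Suc m)) < Y q \<omega>"
    proof
      fix m
      have "0 < inverse (real (Suc m))"
        by simp
      then obtain \<delta> where \<delta>: "0 < \<delta>"
        "\<And>q. q \<in> {0..T} \<Longrightarrow> dist q t < \<delta> \<Longrightarrow> dist (Y q \<omega>) (Y t \<omega>) < inverse (real (Suc m))"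
        using cont[OF \<omega>] t(1) unfolding continuous_on_iff by meson
      obtain q where q: "q \<in> D" "dist q t < \<delta>"
        using D(3) t(1) \<delta>(1) closure_approachable by blast
      then have "dist (Y q \<omega>) (Y t \<omega>) < inverse (real (Suc m))"
        using \<delta>(2) D(2) by blast
      then have "- inverse (real (Suc m)) < Y q \<omega>"
        using t(2) unfolding dist_real_def by linarith
      with q(1) show "\<exists>q\<in>D. - inverse (real (Suc m)) < Y q \<omega>"
        by blast
    qed
  next
    assume near: "\<forall>m. \<exists>q\<in>D. - inverse (real (Suc m)) < Y q \<omega>"
    then have "{0..T} \<noteq> {}"
      using D(2) by blast
    then obtain t where t: "t \<in> {0..T}" "\<And>q. q \<in> {0..T} \<Longrightarrow> Y q \<omega> \<le> Y t \<omega>"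
      using continuous_attains_sup[OF _ _ cont[OF \<omega>]] by auto
    have "0 \<le> Y t \<omega>"
    proof (rule ccontr)
      assume "\<not> 0 \<le> Y t \<omega>"
      then obtain m where "inverse (real (Suc m)) < - Y t \<omega>"
        using reals_Archimedean[of "- Y t \<omega>"] by auto
      moreover obtain q where "q \<in> D" "- inverse (real (Suc m)) < Y q \<omega>"
        using near by blast
      ultimately show False
        using t(2)[of q] D(2) by force
    qed
    with t(1) show "\<exists>t\<in>{0..T}. 0 \<le> Y t \<omega>" by blast
  qed
  then have "{\<omega> \<in> space N. \<exists>t\<in>{0..T}. 0 \<le> Y t \<omega>} =
      {\<omega> \<in> space N. \<forall>m. \<exists>q\<in>D. - inverse (real (Suc m)) < Y q \<omega>}"
    by blast
  also have "\<dots> = (\<Inter>m. \<Union>q\<in>D. {\<omega> \<in> space N. - inverse (real (Suc m)) < Y q \<omega>})"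
    by blast
  also have "\<dots> \<in> sets N"
  proof (rule sets.countable_INT')
    show "range (\<lambda>m. \<Union>q\<in>D. {\<omega> \<in> space N. - inverse (real (Suc m)) < Y q \<omega>}) \<subseteq> sets N"
      using D(2) borel_measurable_less[OF borel_measurable_const meas]
      by (intro image_subsetI sets.countable_UN'[OF D(1)]) blast
  qed auto
  finally show ?thesis .
qed

section \<open>Events of a large deviation principle\<close>

lemma random_LDP_speed: "random_LDP M E Y \<gamma> I \<Longrightarrow> speed \<gamma>"
  by (simp add: random_LDP_def LDP_def)

lemma openin_borel_sigma: "openin E S \<Longrightarrow> S \<in> sets (borel_sigma E)"
  unfolding borel_sigma_def
  by (rule in_measure_of) (auto dest: openin_subset)

lemma closedin_borel_sigma: "closedin E S \<Longrightarrow> S \<in> sets (borel_sigma E)"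
proof -
  assume S: "closedin E S"
  have space: "space (borel_sigma E) = topspace E"
    unfolding borel_sigma_def by (rule space_measure_of) (auto dest: openin_subset)
  have "space (borel_sigma E) - (topspace E - S) \<in> sets (borel_sigma E)"
    using S by (intro sets.compl_sets openin_borel_sigma) (simp add: closedin_def)
  moreover have "space (borel_sigma E) - (topspace E - S) = S"
    using S by (auto simp: space closedin_def)
  ultimately show ?thesis by simp
qed

lemma measure_distr_random_LDP:
  assumes "random_LDP M E Y \<gamma> I" and "S \<in> sets (borel_sigma E)"
  shows "measure (distr M (borel_sigma E) (Y n)) S = measure M {\<omega> \<in> space M. Y n \<omega> \<in> S}"
proof -
  have "measure (distr M (borel_sigma E) (Y n)) S = measure M (Y n -` S \<inter> space M)"
    using assms by (intro measure_distr) (auto simp: random_LDP_def)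
  also have "Y n -` S \<inter> space M = {\<omega> \<in> space M. Y n \<omega> \<in> S}"
    by blast
  finally show ?thesis .
qed

lemma random_LDP_closed:
  assumes LDP: "random_LDP M E Y \<gamma> I" and C: "closedin E C" and "\<And>h. h \<in> C \<Longrightarrow> ereal c \<le> I h"
  shows "decays_at_least \<gamma> (\<lambda>n. measure M {\<omega> \<in> space M. Y n \<omega> \<in> C}) c"
proof (rule decays_at_least_if_limsup[OF random_LDP_speed[OF LDP]])
  show "limsup (\<lambda>n. log_ereal (measure M {\<omega> \<in> space M. Y n \<omega> \<in> C}) / ereal (\<gamma> n)) \<le> - (INF h\<in>C. I h)"
    unfolding measure_distr_random_LDP[OF LDP closedin_borel_sigma[OF C], symmetric] using LDP C
    by (simp add: random_LDP_def LDP_def)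
  show "ereal c \<le> (INF h\<in>C. I h)"
    using assms(3) by (rule INF_greatest)
qed

lemma random_LDP_open:
  assumes LDP: "random_LDP M E Y \<gamma> I" and S: "openin E S" and "h \<in> S" "I h \<le> ereal c"
  shows "decays_at_most \<gamma> (\<lambda>n. measure M {\<omega> \<in> space M. Y n \<omega> \<in> S}) c"
proof (rule decays_at_most_if_liminf[OF random_LDP_speed[OF LDP]])
  show "- (INF h\<in>S. I h) \<le> liminf (\<lambda>n. log_ereal (measure M {\<omega> \<in> space M. Y n \<omega> \<in> S}) / ereal (\<gamma> n))"
    unfolding measure_distr_random_LDP[OF LDP openin_borel_sigma[OF S], symmetric] using LDP S
    by (simp add: random_LDP_def LDP_def)
  show "(INF h\<in>S. I h) \<le> ereal c"
    using assms(3,4) by (rule INF_lower2)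
qed

lemma scale_tail_decays_at_least:
  assumes LDP: "random_LDP M (top_of_set {0..}) A \<gamma> (\<lambda>y. ereal (d * y powr \<theta>))"
    and pos: "0 < d" "0 < \<theta>" "0 \<le> y"
  shows "decays_at_least \<gamma> (\<lambda>n. measure M {\<omega> \<in> space M. y \<le> A n \<omega>}) (d * y powr \<theta>)"
proof -
  have "closedin (top_of_set {0..}) {y..}"
    using pos(3) by (intro closed_subset) auto
  then have "decays_at_least \<gamma> (\<lambda>n. measure M {\<omega> \<in> space M. A n \<omega> \<in> {y..}}) (d * y powr \<theta>)"
    using pos by (intro random_LDP_closed[OF LDP]) (auto intro!: powr_mono2)
  then show ?thesis by simp
qed

lemma (in finite_measure) scale_tail_decays_at_most:
  assumes LDP: "random_LDP M (top_of_set {0..}) A \<gamma> (\<lambda>y. ereal (d * y powr \<theta>))"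
    and events: "\<And>n. {\<omega> \<in> space M. y \<le> A n \<omega>} \<in> sets M" and y: "0 < y" "y < y'"
  shows "decays_at_most \<gamma> (\<lambda>n. measure M {\<omega> \<in> space M. y \<le> A n \<omega>}) (d * y' powr \<theta>)"
proof (rule decays_at_most_mono)
  have "openin (top_of_set {0..}) {y<..}"
    using y by (intro open_subset) auto
  then show "decays_at_most \<gamma> (\<lambda>n. measure M {\<omega> \<in> space M. A n \<omega> \<in> {y<..}}) (d * y' powr \<theta>)"
    by (rule random_LDP_open[OF LDP, where h = y']) (use y in auto)
  show "measure M {\<omega> \<in> space M. A n \<omega> \<in> {y<..}} \<le> measure M {\<omega> \<in> space M. y \<le> A n \<omega>}" for n
    using events by (intro finite_measure_mono) auto
qed

section \<open>The Gaussian rate function on a level crossing\<close>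

text \<open>The choice of \<open>a\<close> is left to the application: optimally \<open>a = \<langle>h(t),\<xi>\<rangle> / \<Sigma>(t)\<close>, and arbitrarily large if
  the variance \<open>\<Sigma>(t)\<close> vanishes. An infinite rate is covered as well.\<close>

lemma gaussian_rate_ge:
  fixes \<xi> :: "real ^ 'p" and h :: "real \<Rightarrow> real ^ 'p"
  assumes paths: "\<And>i. gaussian_paths (N i) T (U i)" and t: "t \<in> {0..T}"
  shows "ereal (a * (h t \<bullet> \<xi>) - a\<^sup>2 / 2 * (\<Sum>i\<in>UNIV. (\<xi> $ i)\<^sup>2 * (\<integral>\<omega>. (U i t \<omega>)\<^sup>2 \<partial>N i)))
    \<le> (\<Sum>i\<in>UNIV. rkhs_rate (N i) T (U i) (component T i h))"
proof -
  let ?V = "\<lambda>i. \<integral>\<omega>. (U i t \<omega>)\<^sup>2 \<partial>N i"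
  have "ereal (a * \<xi> $ i * h t $ i - (a * \<xi> $ i)\<^sup>2 / 2 * ?V i)
      \<le> rkhs_rate (N i) T (U i) (component T i h)" for i
    using gaussian_paths.rkhs_norm_lower_bound[OF paths _ t, of "component T i h" i "a * \<xi> $ i"] t
    by (simp add: rkhs_rate_def component_def)
  then have "(\<Sum>i\<in>UNIV. ereal (a * \<xi> $ i * h t $ i - (a * \<xi> $ i)\<^sup>2 / 2 * ?V i))
      \<le> (\<Sum>i\<in>UNIV. rkhs_rate (N i) T (U i) (component T i h))"
    by (rule sum_mono)
  moreover have "a * (h t \<bullet> \<xi>) - a\<^sup>2 / 2 * (\<Sum>i\<in>UNIV. (\<xi> $ i)\<^sup>2 * ?V i) =
      (\<Sum>i\<in>UNIV. a * \<xi> $ i * h t $ i - (a * \<xi> $ i)\<^sup>2 / 2 * ?V i)"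
    by (simp add: inner_vec_def sum_subtractf sum_distrib_left power_mult_distrib mult_ac)
  ultimately show ?thesis
    by simp
qed

text \<open>The cheapest path with a given value \<open>\<langle>h(t),\<xi>\<rangle>\<close> has the components \<open>c \<xi>\<^sub>i k\<^sub>i\<^sub>i(\<cdot>,t)\<close>.\<close>

lemma gaussian_rate_attained:
  fixes \<xi> :: "real ^ 'p" and \<Sigma> :: real
  assumes paths: "\<And>i. gaussian_paths (N i) T (U i)" and t: "t \<in> {0..T}"
    and "\<And>i. 0 \<le> \<xi> $ i" "0 \<le> c"
  defines "\<Sigma> \<equiv> (\<Sum>i\<in>UNIV. (\<xi> $ i)\<^sup>2 * (\<integral>\<omega>. (U i t \<omega>)\<^sup>2 \<partial>N i))"
  obtains h where "h \<in> topspace (path_topology T)" "h t \<bullet> \<xi> = c * \<Sigma>"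
    and "(\<Sum>i\<in>UNIV. rkhs_rate (N i) T (U i) (component T i h)) = ereal (c\<^sup>2 / 2 * \<Sigma>)"
proof -
  define g where "g = (\<lambda>i. \<lambda>s\<in>{0..T}. c * \<xi> $ i * (\<integral>\<omega>. U i s \<omega> * U i t \<omega> \<partial>N i))"
  define h where "h = (\<lambda>s\<in>{0..T}. \<chi> i. g i s)"
  have nonneg: "0 \<le> c * \<xi> $ i" for i
    using assms(3,4) by simp
  have kernel: "g i \<in> rkhs (N i) T (U i)"
    "(rkhs_norm (N i) T (U i) (g i))\<^sup>2 = (c * \<xi> $ i)\<^sup>2 * (\<integral>\<omega>. (U i t \<omega>)\<^sup>2 \<partial>N i)"
    "continuous_on {0..T} (g i)" for i
    using gaussian_paths.rkhs_kernel_section[OF paths[of i] t nonneg[of i]] by (simp_all add: g_def)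
  have component: "component T i h = g i" for i
    by (auto simp: component_def h_def g_def)
  show ?thesis
  proof
    have "continuous_on {0..T} (\<lambda>s. \<chi> i. g i s)"
      using kernel(3) by (intro continuous_on_vec_lambda)
    then have "continuous_on {0..T} h"
      by (rule continuous_on_cong[THEN iffD1, rotated 2]) (auto simp: h_def)
    then show "h \<in> topspace (path_topology T)"
      by (simp add: topspace_path_topology h_def)
    show "h t \<bullet> \<xi> = c * \<Sigma>"
      using t by (simp add: h_def g_def \<Sigma>_def inner_vec_def sum_distrib_left power2_eq_square mult_ac)
    have "rkhs_rate (N i) T (U i) (component T i h) =
        ereal (c\<^sup>2 / 2 * ((\<xi> $ i)\<^sup>2 * (\<integral>\<omega>. (U i t \<omega>)\<^sup>2 \<partial>N i)))" for i
      using kernel(1,2)[of i] by (simp add: component rkhs_rate_def power_mult_distrib)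
    then show "(\<Sum>i\<in>UNIV. rkhs_rate (N i) T (U i) (component T i h)) = ereal (c\<^sup>2 / 2 * \<Sigma>)"
      by (simp add: \<Sigma>_def sum_distrib_left)
  qed
qed

section \<open>Independence and the decay rate\<close>

lemma generated_measurable:
  "j \<in> J \<Longrightarrow> Y j \<in> borel_measurable (vimage_algebra (space M) (\<lambda>\<omega>. \<lambda>j\<in>J. Y j \<omega>) (Pi\<^sub>M J (\<lambda>_. borel)))"
proof -
  assume j: "j \<in> J"
  have "(\<lambda>\<omega>. \<lambda>j\<in>J. Y j \<omega>) \<in> measurable
      (vimage_algebra (space M) (\<lambda>\<omega>. \<lambda>j\<in>J. Y j \<omega>) (Pi\<^sub>M J (\<lambda>_. borel))) (Pi\<^sub>M J (\<lambda>_. borel))"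
    by (rule measurable_vimage_algebra1) (auto simp: space_PiM)
  from measurable_compose[OF this measurable_component_singleton[OF j]] j
  show ?thesis by simp
qed

lemma measurable_if_generated_events:
  assumes "generated_events M J Y \<subseteq> sets M" "j \<in> J"
  shows "Y j \<in> borel_measurable M"
  by (rule measurable_from_subalg[OF _ generated_measurable[OF assms(2)]])
     (use assms(1) in \<open>simp add: subalgebra_def generated_events_def\<close>)

text \<open>Comparing the decay rate with a real number replaces the infimum by one inequality for each time.\<close>

lemma le_w_H_eq_iff:
  assumes "0 < psi d \<theta>"
  shows "ereal c \<le> w_H_eq T d \<theta> k b \<xi> x \<longleftrightarrow> (\<forall>t\<in>{0..T}. ereal (c / psi d \<theta>) \<le> ereal_powr
    (ereal (1 / 2) * (ereal ((- (b t \<bullet> \<xi>) + x)\<^sup>2) / ereal (\<Sum>j\<in>UNIV. (\<xi> $ j)\<^sup>2 * k j t t)))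
    (\<theta> / (\<theta> + 2)))"
  using assms unfolding w_H_eq_def
  by (subst ereal_divide_le_pos[symmetric]) (auto simp: le_INF_iff)

lemma ereal_powr_ratio:
  assumes "0 < f" "0 \<le> s"
  shows "ereal_powr (ereal (1 / 2) * (ereal (f\<^sup>2) / ereal s)) a =
    (if s = 0 then \<infinity> else ereal ((f\<^sup>2 / (2 * s)) powr a))"
proof (cases "s = 0")
  case True
  with assms have "ereal (f\<^sup>2) / ereal s = \<infinity>"
    by (simp add: zero_ereal_def[symmetric] divide_ereal_def)
  with True show ?thesis
    by (simp add: ereal_powr_def)
next
  case False
  with assms show ?thesis
    by (simp add: ereal_powr_def)
qed

theorem proposition4p1:
  fixes M :: "'w measure"
    and T :: real
    and X :: "nat \<Rightarrow> real \<Rightarrow> 'w \<Rightarrow> real ^ 'p"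
    and A :: "nat \<Rightarrow> 'w \<Rightarrow> real"
    and N :: "'p \<Rightarrow> 'u measure"
    and U :: "'p \<Rightarrow> real \<Rightarrow> 'u \<Rightarrow> real"
    and k :: "'p \<Rightarrow> real \<Rightarrow> real \<Rightarrow> real"
    and \<gamma> :: "nat \<Rightarrow> real"
    and d \<theta> x :: real
    and b :: "real \<Rightarrow> real ^ 'p"
    and \<xi> :: "real ^ 'p"
    and Z :: "nat \<Rightarrow> real \<Rightarrow> 'w \<Rightarrow> real ^ 'p"
    and p :: "nat \<Rightarrow> real"
  assumes T_pos: "0 < T"
    and prob_M: "prob_space M"
    and X_cont: "\<And>n. continuous_process M T (X n)"
    and X_gauss: "\<And>n. centered_gaussian_process M T (X n)"
    and X_zero: "\<And>n \<omega>. \<omega> \<in> space M \<Longrightarrow> X n 0 \<omega> = 0"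
    and X_indep: "\<And>n. prob_space.indep_vars M (\<lambda>_. Pi\<^sub>M {0..T} (\<lambda>_. borel))
                   (\<lambda>i \<omega>. \<lambda>t\<in>{0..T}. X n t \<omega> $ i) UNIV"
    and U_prob: "\<And>i. prob_space (N i)"
    and U_cont: "\<And>i. continuous_process (N i) T (U i)"
    and U_gauss: "\<And>i. centered_gaussian_process (N i) T (U i)"
    and U_cov: "\<And>i. covariance_function (N i) T (U i) (k i)"
    and X_LDP: "random_LDP M (path_topology T) (\<lambda>n. sample_path T (X n)) \<gamma>
                  (\<lambda>h. \<Sum>i\<in>UNIV. rkhs_rate (N i) T (U i) (component T i h))"
    and X_good: "good_rate_function (path_topology T)
                  (\<lambda>h. \<Sum>i\<in>UNIV. rkhs_rate (N i) T (U i) (component T i h))"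
    and A_pos: "\<And>n \<omega>. \<omega> \<in> space M \<Longrightarrow> 0 < A n \<omega>"
    and A_X_indep: "prob_space.indep_set M
                      (generated_events M UNIV A)
                      (generated_events M (UNIV \<times> {0..T}) (\<lambda>(n, t). X n t))"
    and d_pos: "0 < d" and theta_pos: "0 < \<theta>"
    and A_LDP: "random_LDP M (top_of_set {0..}) A \<gamma> (\<lambda>y. ereal (d * y powr \<theta>))"
    and A_good: "good_rate_function (top_of_set {0..}) (\<lambda>y::real. ereal (d * y powr \<theta>))"
    and b_cont: "continuous_on {0..T} b"
    and Z_def: "\<And>n t \<omega>. Z n t \<omega> = A n \<omega> *\<^sub>R X n t \<omega> + b t"
    and xi_nz: "\<xi> \<noteq> 0" and xi_nonneg: "\<And>i. 0 \<le> \<xi> $ i"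
    and x_pos: "0 < x"
    and x_gap: "\<And>t. t \<in> {0..T} \<Longrightarrow> 0 < x - b t \<bullet> \<xi>"
    and p_def: "\<And>n. p n = measure M {\<omega> \<in> space M. x \<le> (SUP t\<in>{0..T}. Z n t \<omega> \<bullet> \<xi>)}"
  shows "(\<lambda>n. log_ereal (p n) / ereal (\<gamma> n)) \<longlonglongrightarrow> - w_H_eq T d \<theta> k b \<xi> x"
proof -
  interpret prob_space M
    by (rule prob_M)
  define f where "f = (\<lambda>t. x - b t \<bullet> \<xi>)"
  define \<Sigma> where "\<Sigma> = (\<lambda>t. \<Sum>i\<in>UNIV. (\<xi> $ i)\<^sup>2 * (\<integral>\<omega>. (U i t \<omega>)\<^sup>2 \<partial>N i))"
  define crossing where
    "crossing = (\<lambda>v n. {\<omega> \<in> space M. \<exists>t\<in>{0..T}. v * f t \<le> X n t \<omega> \<bullet> \<xi>})"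
  define a where "a = (\<lambda>y n. prob {\<omega> \<in> space M. y \<le> A n \<omega>})"
  define v where "v = (\<lambda>u n. prob (crossing u n))"
  let ?a = "\<theta> / (\<theta> + 2)"
  have f: "continuous_on {0..T} f" "\<And>t. t \<in> {0..T} \<Longrightarrow> 0 < f t"
    unfolding f_def using x_gap by (auto intro!: continuous_intros b_cont)
  have \<gamma>: "speed \<gamma>"
    using A_LDP by (rule random_LDP_speed)
  have \<psi>: "0 < psi d \<theta>"
    using d_pos theta_pos by (rule psi_pos)
  have paths: "gaussian_paths (N i) T (U i)" for i
    using U_prob U_gauss U_cont by (simp add: gaussian_paths_def gaussian_paths_axioms_def)
  have \<Sigma>_nonneg: "0 \<le> \<Sigma> t" for t
    unfolding \<Sigma>_def by (intro sum_nonneg mult_nonneg_nonneg) auto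
  have \<Sigma>_k: "(\<Sum>j\<in>UNIV. (\<xi> $ j)\<^sup>2 * k j t t) = \<Sigma> t" if "t \<in> {0..T}" for t
    using gaussian_paths.covariance_eq[OF paths U_cov that that]
    by (simp add: \<Sigma>_def power2_eq_square)
  have decay_term: "ereal_powr
      (ereal (1 / 2) * (ereal ((- (b t \<bullet> \<xi>) + x)\<^sup>2) / ereal (\<Sum>j\<in>UNIV. (\<xi> $ j)\<^sup>2 * k j t t))) ?a =
      (if \<Sigma> t = 0 then \<infinity> else ereal (((f t)\<^sup>2 / (2 * \<Sigma> t)) powr ?a))" if t: "t \<in> {0..T}" for t
    using ereal_powr_ratio[OF f(2)[OF t] \<Sigma>_nonneg[of t]] \<Sigma>_k[OF t]
    by (simp add: f_def)
  have le_rate_iff: "ereal c \<le> w_H_eq T d \<theta> k b \<xi> x \<longleftrightarrow>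
      (\<forall>t\<in>{0..T}. \<Sigma> t \<noteq> 0 \<longrightarrow> c / psi d \<theta> \<le> ((f t)\<^sup>2 / (2 * \<Sigma> t)) powr ?a)" for c
    unfolding le_w_H_eq_iff[OF \<psi>]
  proof (intro ball_cong refl)
    fix t assume t: "t \<in> {0..T}"
    show "ereal (c / psi d \<theta>) \<le> ereal_powr
      (ereal (1 / 2) * (ereal ((- (b t \<bullet> \<xi>) + x)\<^sup>2) / ereal (\<Sum>j\<in>UNIV. (\<xi> $ j)\<^sup>2 * k j t t))) ?a \<longleftrightarrow>
      (\<Sigma> t \<noteq> 0 \<longrightarrow> c / psi d \<theta> \<le> ((f t)\<^sup>2 / (2 * \<Sigma> t)) powr ?a)"
      unfolding decay_term[OF t] by simp
  qed

  have X_paths: "continuous_on {0..T} (\<lambda>t. X n t \<omega>)" if "\<omega> \<in> space M" for n \<omega>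
    using X_cont that by (simp add: continuous_process_def)
  have generated: "generated_events M UNIV A \<subseteq> events"
    "generated_events M (UNIV \<times> {0..T}) (\<lambda>(n, t). X n t) \<subseteq> events"
    using A_X_indep unfolding indep_sets2_eq by blast+
  have A_meas[measurable]: "A n \<in> borel_measurable M" for n
    using measurable_if_generated_events[OF generated(1)] by simp
  have X_meas[measurable]: "X n t \<in> borel_measurable M" if "t \<in> {0..T}" for n t
    using measurable_if_generated_events[OF generated(2), of "(n, t)"] that by simp
  have scale_event: "{\<omega> \<in> space M. y \<le> A n \<omega>} \<in> generated_events M UNIV A" for y n
  proof -
    let ?G = "vimage_algebra (space M) (\<lambda>\<omega>. \<lambda>j\<in>UNIV. A j \<omega>) (Pi\<^sub>M UNIV (\<lambda>_. borel))"
    have "{\<omega> \<in> space ?G. y \<le> A n \<omega>} \<in> sets ?G"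
      by (intro borel_measurable_le borel_measurable_const generated_measurable UNIV_I)
    then show ?thesis
      by (simp add: generated_events_def)
  qed
  have crossing_event: "crossing u n \<in> generated_events M (UNIV \<times> {0..T}) (\<lambda>(n, t). X n t)" for u n
  proof -
    let ?G = "vimage_algebra (space M) (\<lambda>\<omega>. \<lambda>j\<in>UNIV \<times> {0..T}. (case j of (n, t) \<Rightarrow> X n t) \<omega>)
        (Pi\<^sub>M (UNIV \<times> {0..T}) (\<lambda>_. borel))"
    have "{\<omega> \<in> space ?G. \<exists>t\<in>{0..T}. 0 \<le> X n t \<omega> \<bullet> \<xi> - u * f t} \<in> sets ?G"
    proof (rule level_crossing_measurable)
      fix t assume "t \<in> {0..T}"
      then have [measurable]: "X n t \<in> borel_measurable ?G"
        using generated_measurable[of "(n, t)" "UNIV \<times> {0..T}" "\<lambda>(n, t). X n t"] by simp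
      show "(\<lambda>\<omega>. X n t \<omega> \<bullet> \<xi> - u * f t) \<in> borel_measurable ?G"
        by measurable
    qed (use X_paths in \<open>auto intro!: continuous_intros f(1)\<close>)
    then show ?thesis
      by (simp add: generated_events_def crossing_def)
  qed
  have events: "{\<omega> \<in> space M. y \<le> A n \<omega>} \<in> events" "crossing u n \<in> events" for y u n
    using scale_event crossing_event generated by blast+
  have indep: "prob ({\<omega> \<in> space M. y \<le> A n \<omega>} \<inter> crossing u n) = a y n * v u n" for y u n
    unfolding a_def v_def using A_X_indep scale_event crossing_event by (rule indep_setD)

  define E where "E = (\<lambda>n. {\<omega> \<in> space M. \<exists>t\<in>{0..T}. f t \<le> A n \<omega> * (X n t \<omega> \<bullet> \<xi>)})"
  have p: "p n = prob (E n)" for n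
  proof -
    have "x \<le> (SUP t\<in>{0..T}. Z n t \<omega> \<bullet> \<xi>) \<longleftrightarrow> (\<exists>t\<in>{0..T}. f t \<le> A n \<omega> * (X n t \<omega> \<bullet> \<xi>))"
      if \<omega>: "\<omega> \<in> space M" for \<omega>
    proof -
      have "continuous_on {0..T} (\<lambda>t. Z n t \<omega> \<bullet> \<xi>)"
        unfolding Z_def by (intro continuous_intros X_paths \<omega> b_cont)
      then obtain s where s: "s \<in> {0..T}" "\<And>t. t \<in> {0..T} \<Longrightarrow> Z n t \<omega> \<bullet> \<xi> \<le> Z n s \<omega> \<bullet> \<xi>"
        using T_pos continuous_attains_sup[of "{0..T}" "\<lambda>t. Z n t \<omega> \<bullet> \<xi>"] by auto
      have "(SUP t\<in>{0..T}. Z n t \<omega> \<bullet> \<xi>) = Z n s \<omega> \<bullet> \<xi>"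
        by (rule cSup_eq_maximum) (use s in auto)
      then have "x \<le> (SUP t\<in>{0..T}. Z n t \<omega> \<bullet> \<xi>) \<longleftrightarrow> (\<exists>t\<in>{0..T}. x \<le> Z n t \<omega> \<bullet> \<xi>)"
        using s by (auto intro: order_trans)
      then show ?thesis
        by (simp add: Z_def f_def inner_add_left algebra_simps)
    qed
    then have "{\<omega> \<in> space M. x \<le> (SUP t\<in>{0..T}. Z n t \<omega> \<bullet> \<xi>)} = E n"
      unfolding E_def by blast
    then show ?thesis
      by (simp add: p_def)
  qed
  have E_event: "E n \<in> events" for n
  proof -
    have "{\<omega> \<in> space M. \<exists>t\<in>{0..T}. 0 \<le> A n \<omega> * (X n t \<omega> \<bullet> \<xi>) - f t} \<in> events"
      by (rule level_crossing_measurable)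
         (use X_paths in \<open>auto intro!: continuous_intros f(1) borel_measurable_diff
            borel_measurable_times borel_measurable_inner A_meas X_meas\<close>)
    then show ?thesis
      by (simp add: E_def)
  qed
  have crossing_if_scale_le: "\<omega> \<in> crossing (1 / y) n"
    if \<omega>: "\<omega> \<in> E n" and y: "A n \<omega> \<le> y" for \<omega> y n
  proof -
    obtain t where t: "t \<in> {0..T}" "f t \<le> A n \<omega> * (X n t \<omega> \<bullet> \<xi>)" and "\<omega> \<in> space M"
      using \<omega> by (auto simp: E_def)
    have A0: "0 < A n \<omega>"
      using A_pos \<open>\<omega> \<in> space M\<close> .
    then have "0 < X n t \<omega> \<bullet> \<xi>"
      using t f(2)[OF t(1)] by (metis less_le_trans zero_less_mult_pos)
    then have "f t \<le> y * (X n t \<omega> \<bullet> \<xi>)"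
      using t(2) y by (meson less_imp_le mult_right_mono order_trans)
    then have "1 / y * f t \<le> X n t \<omega> \<bullet> \<xi>"
      using A0 y by (simp add: field_simps)
    with t(1) \<open>\<omega> \<in> space M\<close> show ?thesis
      by (auto simp: crossing_def)
  qed
  have split: "a y n * v (1 / y) n \<le> p n" if y: "0 < y" for y n
  proof -
    have "\<omega> \<in> E n" if \<omega>: "\<omega> \<in> space M" "y \<le> A n \<omega>" "\<omega> \<in> crossing (1 / y) n" for \<omega>
    proof -
      from \<omega>(3) obtain t where t: "t \<in> {0..T}" "1 / y * f t \<le> X n t \<omega> \<bullet> \<xi>"
        by (auto simp: crossing_def)
      then have "0 \<le> X n t \<omega> \<bullet> \<xi>"
        using y f(2)[OF t(1)] by (meson divide_nonneg_pos less_imp_le mult_nonneg_nonneg order_trans zero_le_one)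
      then have "y * (X n t \<omega> \<bullet> \<xi>) \<le> A n \<omega> * (X n t \<omega> \<bullet> \<xi>)"
        using \<omega>(2) by (intro mult_right_mono)
      moreover have "f t \<le> y * (X n t \<omega> \<bullet> \<xi>)"
        using t(2) y by (simp add: field_simps)
      ultimately show ?thesis
        using t(1) \<omega>(1) by (auto simp: E_def intro: order_trans)
    qed
    then show ?thesis
      unfolding indep[symmetric] p using E_event by (intro finite_measure_mono) auto
  qed
  have cover: "p n \<le> v (1 / y 0) n + a (y m) n + (\<Sum>j<m. a (y j) n * v (1 / y (Suc j)) n)"
    if y: "\<And>j. 0 < y j" for y :: "nat \<Rightarrow> real" and m n
  proof -
    let ?S = "\<lambda>j. {\<omega> \<in> space M. y j \<le> A n \<omega>}"
    let ?J = "\<Union>j<m. ?S j \<inter> crossing (1 / y (Suc j)) n"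
    have "\<omega> \<in> (crossing (1 / y 0) n \<union> ?S m) \<union> ?J" if \<omega>: "\<omega> \<in> E n" for \<omega>
    proof -
      have "\<omega> \<in> space M"
        using \<omega> by (simp add: E_def)
      have step: "A n \<omega> \<le> y 0 \<or> y m \<le> A n \<omega> \<or> (\<exists>j<m. y j \<le> A n \<omega> \<and> A n \<omega> \<le> y (Suc j))"
      proof (induction m)
        case (Suc m)
        then show ?case
          by (metis less_Suc_eq linear)
      qed linarith
      from step show ?thesis
        using crossing_if_scale_le[OF \<omega>] \<open>\<omega> \<in> space M\<close> by blast
    qed
    then have "p n \<le> prob ((crossing (1 / y 0) n \<union> ?S m) \<union> ?J)"
      unfolding p using events by (intro finite_measure_mono) (auto intro!: sets.Int sets.finite_UN)
    also have "\<dots> \<le> prob (crossing (1 / y 0) n \<union> ?S m) + prob ?J"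
      using events by (intro measure_Un_le) (auto intro!: sets.Int sets.finite_UN)
    also have "\<dots> \<le> (prob (crossing (1 / y 0) n) + prob (?S m)) +
        (\<Sum>j<m. prob (?S j \<inter> crossing (1 / y (Suc j)) n))"
      using events
      by (intro add_mono measure_Un_le finite_measure_subadditive_finite) auto
    finally show ?thesis
      unfolding indep by (simp add: a_def v_def)
  qed
  have nonneg: "0 \<le> a y n" "0 \<le> v u n" for y u n
    by (simp_all add: a_def v_def)

  have sample_path: "sample_path T (X n) \<omega> \<in> topspace (path_topology T)" if "\<omega> \<in> space M" for n \<omega>
  proof -
    have "continuous_on {0..T} (sample_path T (X n) \<omega>)"
      by (rule continuous_on_cong[THEN iffD1, OF refl _ X_paths[OF that]]) (simp add: sample_path_def)
    then show ?thesis
      by (simp add: topspace_path_topology sample_path_def)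
  qed
  let ?I = "\<lambda>h. \<Sum>i\<in>UNIV. rkhs_rate (N i) T (U i) (component T i h)"

  show ?thesis
  proof (rule log_rate_tendsto[OF \<gamma>])
    show "0 \<le> p n" for n
      by (simp add: p)
  next
    fix c assume c: "ereal c < w_H_eq T d \<theta> k b \<xi> x"
    show "decays_at_least \<gamma> p c"
    proof (cases "c \<le> 0")
      case True
      have "p n \<le> exp (- (\<gamma> n * c'))" if "c' < c" for c' n
      proof -
        have "0 \<le> - (\<gamma> n * c')"
          using True that speed_pos[OF \<gamma>, of n] by (simp add: mult_le_0_iff)
        then have "1 \<le> exp (- (\<gamma> n * c'))"
          by simp
        then show ?thesis
          unfolding p using prob_le_1 order_trans by blast
      qed
      then show ?thesis
        by (simp add: decays_at_least_def)
    next
      case False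
      \<comment> \<open>The value of \<open>m\<close> at which the decay rate would be exactly \<open>c\<close>.\<close>
      define q where "q = (c / psi d \<theta>) powr (1 / ?a)"
      have q: "0 < q" "q powr ?a = c / psi d \<theta>"
        using False \<psi> theta_pos by (simp_all add: q_def powr_powr)
      have q_le: "q * (2 * \<Sigma> t) \<le> (f t)\<^sup>2" if t: "t \<in> {0..T}" for t
      proof (cases "\<Sigma> t = 0")
        case False
        then have pos: "0 < \<Sigma> t"
          using \<Sigma>_nonneg[of t] by simp
        have "c / psi d \<theta> \<le> ((f t)\<^sup>2 / (2 * \<Sigma> t)) powr ?a"
          using le_rate_iff[of c] less_imp_le[OF c] t False by blast
        then have "q powr ?a \<le> ((f t)\<^sup>2 / (2 * \<Sigma> t)) powr ?a"
          by (simp add: q)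
        then have "q \<le> (f t)\<^sup>2 / (2 * \<Sigma> t)"
          using theta_pos q(1) pos by (metis add_pos_pos divide_pos_pos linorder_not_less powr_less_mono2
              zero_le_power2 divide_nonneg_pos mult_pos_pos zero_less_numeral)
        then show ?thesis
          using pos by (simp add: field_simps)
      qed simp
      have v_decay: "decays_at_least \<gamma> (v u) (q * u\<^sup>2)" if u: "0 < u" for u
      proof -
        let ?C = "{h \<in> topspace (path_topology T). \<exists>t\<in>{0..T}. u * f t \<le> h t \<bullet> \<xi>}"
        have "ereal (q * u\<^sup>2) \<le> ?I h" if h: "h \<in> ?C" for h
        proof -
          from h obtain t where t: "t \<in> {0..T}" "u * f t \<le> h t \<bullet> \<xi>"
            by blast
          \<comment> \<open>A multiplier in which the variance does not occur; the bound \<open>q_le\<close> makes it good enough also where the variance vanishes.\<close>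
          define s where "s = 2 * q * u / f t"
          have s: "0 \<le> s" "s * f t = 2 * q * u"
            using f(2)[OF t(1)] q(1) u by (simp_all add: s_def)
          have "s\<^sup>2 / 2 * \<Sigma> t = q * (2 * \<Sigma> t) * (q * u\<^sup>2) / (f t)\<^sup>2"
            by (simp add: s_def power_divide power_mult_distrib power2_eq_square[of q])
          also have "\<dots> \<le> (f t)\<^sup>2 * (q * u\<^sup>2) / (f t)\<^sup>2"
            using q_le[OF t(1)] q(1) by (intro divide_right_mono mult_right_mono) auto
          also have "\<dots> = q * u\<^sup>2"
            using f(2)[OF t(1)] by simp
          finally have "s\<^sup>2 / 2 * \<Sigma> t \<le> q * u\<^sup>2" .
          moreover have "2 * (q * u\<^sup>2) \<le> s * (h t \<bullet> \<xi>)"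
          proof -
            have "2 * (q * u\<^sup>2) = s * (u * f t)"
              using s(2) by (simp add: power2_eq_square mult_ac)
            also have "\<dots> \<le> s * (h t \<bullet> \<xi>)"
              using t(2) s(1) by (rule mult_left_mono)
            finally show ?thesis .
          qed
          ultimately have "q * u\<^sup>2 \<le> s * (h t \<bullet> \<xi>) - s\<^sup>2 / 2 * \<Sigma> t"
            by linarith
          then show ?thesis
            using gaussian_rate_ge[where N = N and U = U and a = s and \<xi> = \<xi> and h = h, OF paths t(1)]
            unfolding \<Sigma>_def
            by (meson ereal_less_eq(3) order_trans)
        qed
        then have "decays_at_least \<gamma> (\<lambda>n. prob {\<omega> \<in> space M. sample_path T (X n) \<omega> \<in> ?C}) (q * u\<^sup>2)"
          using T_pos by (intro random_LDP_closed[OF X_LDP] closedin_level_crossing continuous_intros f) auto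
        moreover have "{\<omega> \<in> space M. sample_path T (X n) \<omega> \<in> ?C} = crossing u n" for n
          using sample_path by (auto simp: crossing_def sample_path_def)
        ultimately show ?thesis
          by (simp add: v_def)
      qed
      have "decays_at_least \<gamma> p (psi d \<theta> * q powr ?a)"
      proof (rule product_decays_at_least[where a = a and v = v, OF \<gamma> d_pos theta_pos q(1) _ v_decay nonneg cover])
        show "decays_at_least \<gamma> (a y) (d * y powr \<theta>)" if "0 < y" for y
          unfolding a_def using A_LDP d_pos theta_pos less_imp_le[OF that]
          by (rule scale_tail_decays_at_least)
      qed
      then show ?thesis
        using \<psi> by (simp add: q)
    qed
  next
    fix c assume "w_H_eq T d \<theta> k b \<xi> x < ereal c"
    then have "\<not> ereal c \<le> w_H_eq T d \<theta> k b \<xi> x"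
      by (simp only: not_le)
    then obtain t where t: "t \<in> {0..T}" and "\<Sigma> t \<noteq> 0"
      and c: "((f t)\<^sup>2 / (2 * \<Sigma> t)) powr ?a < c / psi d \<theta>"
      unfolding le_rate_iff not_le[symmetric] by blast
    then have pos: "0 < \<Sigma> t"
      using \<Sigma>_nonneg[of t] by simp
    define q where "q = (f t)\<^sup>2 / (2 * \<Sigma> t)"
    have q: "0 < q"
      using pos f(2)[OF t] by (simp add: q_def)
    have v_decay: "decays_at_most \<gamma> (v u) (q * u'\<^sup>2)" if u: "0 < u" "u < u'" for u u'
    proof (rule decays_at_most_mono)
      let ?O = "{h \<in> topspace (path_topology T). \<exists>t\<in>{0..T}. u * f t < h t \<bullet> \<xi>}"
      \<comment> \<open>The factor for which the kernel section crosses at the level \<open>u' f(t)\<close>, strictly above \<open>u f(t)\<close>.\<close>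
      define s where "s = u' * f t / \<Sigma> t"
      have s: "0 \<le> s" "s * \<Sigma> t = u' * f t"
        using pos f(2)[OF t] u by (simp_all add: s_def)
      obtain h where h: "h \<in> topspace (path_topology T)" "h t \<bullet> \<xi> = s * \<Sigma> t"
        "?I h = ereal (s\<^sup>2 / 2 * \<Sigma> t)"
        using gaussian_rate_attained[where N = N and U = U and \<xi> = \<xi>, OF paths t xi_nonneg s(1)]
        unfolding \<Sigma>_def by blast
      have "u * f t < h t \<bullet> \<xi>"
        using h(2) s(2) u(2) f(2)[OF t] by simp
      then have "h \<in> ?O"
        using h(1) t by blast
      moreover have "s\<^sup>2 / 2 * \<Sigma> t = q * u'\<^sup>2"
        using pos by (simp add: s_def q_def power_divide power_mult_distrib power2_eq_square[of "\<Sigma> t"] mult_ac)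
      ultimately show "decays_at_most \<gamma> (\<lambda>n. prob {\<omega> \<in> space M. sample_path T (X n) \<omega> \<in> ?O}) (q * u'\<^sup>2)"
        using h(3) T_pos by (intro random_LDP_open[OF X_LDP, of _ h] openin_level_crossing) auto
      show "prob {\<omega> \<in> space M. sample_path T (X n) \<omega> \<in> ?O} \<le> v u n" for n
        unfolding v_def using events(2)
        by (intro finite_measure_mono) (auto simp: crossing_def sample_path_def intro: less_imp_le)
    qed
    have "decays_at_most \<gamma> p (psi d \<theta> * q powr ?a)"
    proof (rule product_decays_at_most[where a = a and v = v, OF d_pos theta_pos q _ v_decay nonneg split])
      show "decays_at_most \<gamma> (a y) (d * y' powr \<theta>)" if "0 < y" "y < y'" for y y'
        unfolding a_def using A_LDP events(1) that by (rule scale_tail_decays_at_most)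
    qed
    moreover have "psi d \<theta> * q powr ?a < c"
      using c \<psi> by (simp add: q_def field_simps)
    ultimately show "decays_at_most \<gamma> p c"
      by (auto simp: decays_at_most_def)
  qed
qed

end
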